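(* Let $N\ge2$ be an integer. For $\gamma\in\mathbb{R}$ let $$J_\gamma(v)=\int_0^1 e^{\left(\log\frac{e}{s}+\gamma\log\log\frac{e}{s}\right)\frac{v^N(s)}{s^{N-1}}}\,ds .$$ Then $$\sup_{v\in E_N}J_\gamma(v)<\infty\iff\gamma\le1 .$$ For $\gamma=1$ there is loss of compactness: the functional $J_1$ fails to be weakly continuous along the infinitesimal Moser sequence $\{w_j\}$. More precisely, as $j\to\infty$: (i) if $\gamma>1$, then $J_\gamma(w_j)\to+\infty$; (ii) if $\gamma=1$, then $J_1(w_j)\to c$ for some constant $c\ge e+1>1=J_1(0)$; (iii) if $\gamma<1$, then $J_\gamma(w_j)\to 1=J_\gamma(0)$.
   Context: $E_N:=\left\{u\in W^{1,N}(0,1): u(0)=0,\ \int_0^1|u'|^N\,dx=1\right\}$ (real-valued functions, identified with their continuous representatives), and $v^N(s)=(v(s))^N$. The infinitesimal Moser sequence $\{w_j\}_{j\ge1}$ is defined on $[0,1]$ by $w_j(t)=j^{1/N}t$ for $0\le t\le \frac1j$ and $w_j(t)=j^{-\frac{N-1}{N}}$ for $\frac1j\le t\le1$; one has $w_j\in E_N$ and $w_j\rightharpoonup 0$ weakly in $W^{1,N}(0,1)$. *)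

theory Defs
  imports "HOL-Analysis.Analysis"
begin

abbreviation unit_measure :: "real measure" where
  "unit_measure \<equiv> lebesgue_on {0<..<1}"

definition test_function :: "(real \<Rightarrow> real) \<Rightarrow> bool" where
  "test_function \<phi> \<longleftrightarrow>
     (\<forall>k x. (deriv ^^ k) \<phi> differentiable (at x)) \<and>
     (\<exists>K. compact K \<and> K \<subseteq> {0<..<1} \<and> (\<forall>x. x \<notin> K \<longrightarrow> \<phi> x = 0))"

definition locally_integrable :: "(real \<Rightarrow> real) \<Rightarrow> bool" where
  "locally_integrable g \<longleftrightarrow>
     (\<forall>K. compact K \<and> K \<subseteq> {0<..<1} \<longrightarrow> g absolutely_integrable_on K)"

definition is_weak_deriv :: "(real \<Rightarrow> real) \<Rightarrow> (real \<Rightarrow> real) \<Rightarrow> bool" where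
  "is_weak_deriv u g \<longleftrightarrow> locally_integrable u \<and> locally_integrable g \<and>
     (\<forall>\<phi>. test_function \<phi> \<longrightarrow>
        (\<integral>x. u x * deriv \<phi> x \<partial>unit_measure) = - (\<integral>x. g x * \<phi> x \<partial>unit_measure))"

text \<open>A weak derivative is determined only up to null sets; every use below is
  invariant under changing it on a null set.\<close>

definition weak_deriv :: "(real \<Rightarrow> real) \<Rightarrow> real \<Rightarrow> real" where
  "weak_deriv u = (SOME g. is_weak_deriv u g)"

definition Lp :: "nat \<Rightarrow> (real \<Rightarrow> real) set" where
  "Lp p = {f \<in> borel_measurable unit_measure. integrable unit_measure (\<lambda>x. \<bar>f x\<bar> ^ p)}"

text \<open>The Sobolev space $W^{1,p}(0,1)$. Its elements are represented by functions on the reals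
  that are continuous on $[0,1]$ (the continuous representative); values outside $[0,1]$
  are irrelevant throughout.\<close>

definition sobolev :: "nat \<Rightarrow> (real \<Rightarrow> real) set" where
  "sobolev p = {u. continuous_on {0..1} u \<and> u \<in> Lp p \<and> (\<exists>g. is_weak_deriv u g) \<and> weak_deriv u \<in> Lp p}"

definition sobolev_norm :: "nat \<Rightarrow> (real \<Rightarrow> real) \<Rightarrow> real" where
  "sobolev_norm p u = root p ((\<integral>x. \<bar>u x\<bar> ^ p \<partial>unit_measure) + (\<integral>x. \<bar>weak_deriv u x\<bar> ^ p \<partial>unit_measure))"

definition sobolev_dual :: "nat \<Rightarrow> ((real \<Rightarrow> real) \<Rightarrow> real) set" where
  "sobolev_dual p = {L.
     (\<forall>u\<in>sobolev p. \<forall>v\<in>sobolev p. \<forall>a b. L (\<lambda>x. a * u x + b * v x) = a * L u + b * L v) \<and>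
     (\<exists>C. \<forall>u\<in>sobolev p. \<bar>L u\<bar> \<le> C * sobolev_norm p u)}"

definition sobolev_weakly_converges :: "nat \<Rightarrow> (nat \<Rightarrow> real \<Rightarrow> real) \<Rightarrow> (real \<Rightarrow> real) \<Rightarrow> bool" where
  "sobolev_weakly_converges p u l \<longleftrightarrow>
     (\<forall>j\<ge>1. u j \<in> sobolev p) \<and> l \<in> sobolev p \<and>
     (\<forall>L\<in>sobolev_dual p. (\<lambda>j. L (u j)) \<longlonglongrightarrow> L l)"

definition E :: "nat \<Rightarrow> (real \<Rightarrow> real) set" where
  "E N = {u \<in> sobolev N. u 0 = 0 \<and> (\<integral>x. \<bar>weak_deriv u x\<bar> ^ N \<partial>unit_measure) = 1}"

text \<open>The integrand is positive, so the integral is taken with values in $[0,\infty]$.\<close>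

definition J :: "nat \<Rightarrow> real \<Rightarrow> (real \<Rightarrow> real) \<Rightarrow> ennreal" where
  "J N \<gamma> v = (\<integral>\<^sup>+ s. ennreal (exp ((ln (exp 1 / s) + \<gamma> * ln (ln (exp 1 / s))) * (v s ^ N / s ^ (N - 1))))
               \<partial>unit_measure)"

text \<open>Only the indices $j \ge 1$ are meaningful.\<close>

definition moser :: "nat \<Rightarrow> nat \<Rightarrow> real \<Rightarrow> real" where
  "moser N j t = (if t \<le> 1 / real j then real j powr (1 / real N) * t
                  else real j powr (- ((real N - 1) / real N)))"

end

theory Submission
  imports Defs
begin

text \<open>Write \<open>L = ln (e / s)\<close> and \<open>\<psi> = \<bar>v\<bar>\<^sup>N / s\<^sup>N\<^sup>-\<^sup>1\<close>, so that \<open>0 \<le> \<psi> \<le> 1\<close> on \<open>E N\<close> by Hoelder's inequality.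
  If \<open>\<psi> p\<close> is close to 1, almost the whole energy is spent before \<open>p\<close>, and \<open>\<psi> q\<close> falls below 1
  linearly in the relative distance of \<open>p\<close> and \<open>q\<close>. Hence every \<open>v\<close> has a point \<open>r\<close> with
  \<open>1 - \<psi> s \<ge> 4\<^sup>-\<^sup>N \<bar>s - r\<bar> / max s r\<close> for all \<open>s\<close>. For \<open>\<gamma> = 1\<close> the integrand is \<open>(e L / s)\<^sup>\<psi>\<close>; near \<open>r\<close> its
  height is of order \<open>L / r\<close> and it decays exponentially at scale \<open>r / L\<close>, which bounds the integral
  independently of \<open>r\<close>. Exactly this balance is attained by the Moser sequence: near \<open>1 / j\<close> it
  contributes \<open>(1 + ln j) powr (\<gamma> - 1)\<close> times a sequence with a limit \<open>\<ge> e\<close>, and away from \<open>1 / j\<close> it contributes 1 in the limit.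

  Weak convergence of the Moser sequence needs no reflexivity: a functional bounded away from 0 along
  a sparse subsequence would be of size \<open>n\<close> on a signed sum of \<open>n\<close> terms whose norm is only of
  order \<open>n\<close> to the power \<open>1 / N\<close>.\<close>

subsection \<open>Smooth functions and a smooth step\<close>

text \<open>The bound \<open>\<psi> \<le> 1\<close> alone does not suffice: for \<gamma> = 1 it only
  gives the majorant \<open>e * L / s\<close>, which is not integrable at 0. The gap below 1 must
  therefore be quantitative and uniform over \<open>E N\<close>, although the near-extremal point
  may slide to 0, where the weight blows up. This is why distances are divided by
  \<open>max s r\<close>, a scale-invariant quantity. The constant \<open>4 ^ N\<close> comes from a
  triangle inequality. Extending an extremal value at \<open>p\<close> to \<open>q\<close> loses
  half of the relative distance; leftover energy below \<open>1 / 4 ^ N\<close> of that distance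
  lets the increment win back at most a quarter; a quarter remains. The point \<open>r\<close>
  arises by compactness and may be an endpoint. Two obstacles are technical. The derivative in
  \<open>E N\<close> is a chosen representative, known only through test functions, so pointwise
  increments of \<open>v\<close> have to be recovered by testing with smooth steps. And
  \<open>v ^ N\<close> can be negative for odd \<open>N\<close>, while \<gamma> can be negative as
  well, which costs an additive constant.\<close>

definition smooth :: "(real \<Rightarrow> real) \<Rightarrow> bool" where
  "smooth f \<longleftrightarrow> (\<forall>k x. (deriv ^^ k) f differentiable (at x))"

text \<open>A finite order of differentiability permits induction. The Leibniz rule turns a product
  into a sum of products with one factor differentiated, so closure under products is proved order
  by order, and smoothness follows by letting the order vary.\<close>

primrec differentiable_times :: "nat \<Rightarrow> (real \<Rightarrow> real) \<Rightarrow> bool" where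
  "differentiable_times 0 f \<longleftrightarrow> True"
| "differentiable_times (Suc n) f \<longleftrightarrow> (\<forall>x. f differentiable (at x)) \<and> differentiable_times n (deriv f)"

lemma differentiable_times_iff:
  "differentiable_times n f \<longleftrightarrow> (\<forall>k<n. \<forall>x. (deriv ^^ k) f differentiable (at x))"
proof (induction n arbitrary: f)
  case (Suc n)
  have "(\<forall>k<Suc n. \<forall>x. (deriv ^^ k) f differentiable (at x)) \<longleftrightarrow>
    (\<forall>x. f differentiable (at x)) \<and> (\<forall>k<n. \<forall>x. (deriv ^^ k) (deriv f) differentiable (at x))"
    by (simp add: All_less_Suc2 funpow_swap1)
  then show ?case using Suc by simp
qed simp

lemma smooth_iff_differentiable_times: "smooth f \<longleftrightarrow> (\<forall>n. differentiable_times n f)"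
  unfolding smooth_def differentiable_times_iff by blast

text \<open>A family of differentiable functions that is closed under \<open>deriv\<close> is
  invariant under all iterates; it is applied to the family of all
  \<open>flat_exp p\<close>.\<close>

lemma smooth_coinduct:
  assumes "P f" and "\<And>f. P f \<Longrightarrow> (\<forall>x. f differentiable (at x)) \<and> P (deriv f)"
  shows "smooth f"
proof -
  have "P ((deriv ^^ k) f)" for k
    by (induction k) (use assms in auto)
  then show ?thesis unfolding smooth_def using assms(2) by blast
qed

lemma smooth_deriv: "smooth f \<Longrightarrow> smooth (deriv f)"
  unfolding smooth_def by (metis funpow_swap1 funpow_simps_right(2) comp_apply)

lemma smooth_DERIV: "smooth f \<Longrightarrow> (f has_real_derivative deriv f x) (at x)"
  unfolding smooth_def using DERIV_deriv_iff_real_differentiable by (metis funpow_0)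

lemma smooth_continuous_on: "smooth f \<Longrightarrow> continuous_on A f"
  using smooth_DERIV DERIV_isCont continuous_at_imp_continuous_on by blast

lemma smooth_continuous_on_compose:
  "smooth f \<Longrightarrow> continuous_on A g \<Longrightarrow> continuous_on A (\<lambda>x. f (g x))"
  using continuous_on_compose2[OF smooth_continuous_on[of f UNIV]] by blast

lemma smooth_antiderivative:
  assumes "\<And>x. (F has_real_derivative f x) (at x)" "smooth f"
  shows "smooth F"
proof -
  have "deriv F = f" using assms(1) by (auto intro!: ext DERIV_imp_deriv)
  then have "differentiable_times n F" for n
    using assms by (cases n) (auto simp: smooth_iff_differentiable_times real_differentiable_def)
  then show ?thesis by (simp add: smooth_iff_differentiable_times)
qed

lemma differentiable_times_mono: "differentiable_times (Suc n) f \<Longrightarrow> differentiable_times n f"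
  by (auto simp: differentiable_times_iff)

lemma differentiable_times_add:
  "differentiable_times n f \<Longrightarrow> differentiable_times n g \<Longrightarrow> differentiable_times n (\<lambda>x. f x + g x)"
proof (induction n arbitrary: f g)
  case (Suc n)
  then have "deriv (\<lambda>x. f x + g x) = (\<lambda>x. deriv f x + deriv g x)"
    by (auto intro!: ext DERIV_imp_deriv DERIV_add simp: DERIV_deriv_iff_real_differentiable)
  with Suc show ?case by auto
qed simp

lemma differentiable_times_mult:
  "differentiable_times n f \<Longrightarrow> differentiable_times n g \<Longrightarrow> differentiable_times n (\<lambda>x. f x * g x)"
proof (induction n arbitrary: f g)
  case (Suc n)
  then have "deriv (\<lambda>x. f x * g x) = (\<lambda>x. deriv f x * g x + f x * deriv g x)"
    by (intro ext DERIV_imp_deriv)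
       (metis DERIV_deriv_iff_real_differentiable DERIV_mult' add.commute differentiable_times.simps(2))
  moreover have "differentiable_times n (\<lambda>x. deriv f x * g x + f x * deriv g x)"
    using Suc.prems Suc.IH differentiable_times_mono differentiable_times_add by simp
  ultimately show ?case using Suc.prems by auto
qed simp

lemma differentiable_times_affine:
  "differentiable_times n f \<Longrightarrow> differentiable_times n (\<lambda>x. c * f (a * x + b))"
proof (induction n arbitrary: f c)
  case (Suc n)
  have D: "((\<lambda>x. c * f (a * x + b)) has_real_derivative (c * a) * deriv f (a * x + b)) (at x)" for x
  proof -
    have "(f has_real_derivative deriv f (a * x + b)) (at (a * x + b))"
      using Suc.prems by (auto simp: DERIV_deriv_iff_real_differentiable)
    then have "((\<lambda>x. f (a * x + b)) has_real_derivative deriv f (a * x + b) * a) (at x)"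
      by (rule DERIV_chain2[where g = "\<lambda>x. a * x + b"]) (auto intro!: derivative_eq_intros)
    from DERIV_cmult[OF this, of c] show ?thesis by (simp add: ac_simps)
  qed
  have "deriv (\<lambda>x. c * f (a * x + b)) = (\<lambda>x. (c * a) * deriv f (a * x + b))"
    by (intro ext DERIV_imp_deriv D)
  moreover have "differentiable_times n (\<lambda>x. (c * a) * deriv f (a * x + b))"
    using Suc by simp
  ultimately show ?case using D real_differentiable_def by auto
qed simp

lemma smooth_add: "smooth f \<Longrightarrow> smooth g \<Longrightarrow> smooth (\<lambda>x. f x + g x)"
  by (simp add: smooth_iff_differentiable_times differentiable_times_add)

lemma smooth_mult: "smooth f \<Longrightarrow> smooth g \<Longrightarrow> smooth (\<lambda>x. f x * g x)"
  by (simp add: smooth_iff_differentiable_times differentiable_times_mult)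

lemma smooth_affine: "smooth f \<Longrightarrow> smooth (\<lambda>x. c * f (a * x + b))"
  by (simp add: smooth_iff_differentiable_times differentiable_times_affine)

section \<open>Functions that are flat at the origin, and the smooth step built from them\<close>

definition flat_exp :: "real poly \<Rightarrow> real \<Rightarrow> real" where
  "flat_exp p x = (if x \<le> 0 then 0 else poly p (1 / x) * exp (- (1 / x)))"

lemma poly_times_exp_tendsto_0: "((\<lambda>y::real. poly p y * exp (- y)) \<longlongrightarrow> 0) at_top"
proof -
  have "((\<lambda>y. \<Sum>i\<le>degree p. coeff p i * (y ^ i / exp y)) \<longlongrightarrow> (\<Sum>i\<le>degree p. coeff p i * 0)) at_top"
    by (intro tendsto_sum tendsto_mult tendsto_const tendsto_power_div_exp_0)
  then show ?thesis
    by (simp add: poly_altdef sum_distrib_right exp_minus divide_inverse mult.assoc)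
qed

lemma flat_exp_tendsto_0: "(flat_exp p \<longlongrightarrow> 0) (at 0)"
proof (rule filterlim_split_at_real)
  have "\<forall>\<^sub>F x in at_left 0. 0 = flat_exp p x"
    by (simp add: eventually_at_filter flat_exp_def)
  then show "(flat_exp p \<longlongrightarrow> 0) (at_left 0)"
    by (rule tendsto_cong[THEN iffD1]) simp
  have "((\<lambda>x. poly p (1 / x) * exp (- (1 / x))) \<longlongrightarrow> 0) (at_right (0::real))"
    by (rule filterlim_compose[OF poly_times_exp_tendsto_0])
       (simp add: filterlim_inverse_at_top_right flip: inverse_eq_divide)
  moreover have "\<forall>\<^sub>F x in at_right 0. poly p (1 / x) * exp (- (1 / x)) = flat_exp p x"
    by (simp add: eventually_at_filter flat_exp_def)
  ultimately show "(flat_exp p \<longlongrightarrow> 0) (at_right 0)"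
    by (rule Lim_transform_eventually)
qed

text \<open>The polynomial factor in \<open>1 / x\<close> exists for this closure: differentiating
  \<open>p(1 / x) * exp (- 1 / x)\<close> yields the factor \<open>1 / x\<^sup>2\<close> (the
  polynomial \<open>[:0, 0, 1:]\<close>) times \<open>p - pderiv p\<close>, again of the same
  form.\<close>

lemma flat_exp_DERIV:
  "(flat_exp p has_real_derivative flat_exp ((p - pderiv p) * [:0, 0, 1:]) x) (at x)"
proof -
  consider "x < 0" | "x = 0" | "x > 0" by linarith
  then show ?thesis
  proof cases
    case 1
    have "\<forall>\<^sub>F y in nhds x. flat_exp p y = 0"
      using eventually_nhds_in_open[of "{..<0}" x] 1
      by (auto simp: flat_exp_def elim: eventually_mono)
    then have "(flat_exp p has_real_derivative 0) (at x) \<longleftrightarrow> ((\<lambda>_. 0) has_real_derivative (0::real)) (at x)"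
      by (intro DERIV_cong_ev refl)
    then show ?thesis using 1 by (simp add: flat_exp_def[of _ x])
  next
    case 2
    \<comment> \<open>The difference quotient at 0 is itself a flat function, since division by
      \<open>y\<close> multiplies the polynomial by its variable; its limit is therefore already
      known.\<close>
    have "flat_exp p y / y = flat_exp (pCons 0 p) y" for y
      by (simp add: flat_exp_def)
    then have "((\<lambda>y. (flat_exp p y - flat_exp p 0) / (y - 0)) \<longlongrightarrow> 0) (at 0)"
      using flat_exp_tendsto_0[of "pCons 0 p"] by (simp add: flat_exp_def[of p 0])
    then show ?thesis using 2 by (simp add: has_field_derivative_iff flat_exp_def[of _ 0])
  next
    case 3
    have "((\<lambda>y. poly p (1 / y) * exp (- (1 / y))) has_real_derivative
        flat_exp ((p - pderiv p) * [:0, 0, 1:]) x) (at x)"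
      using 3 by (auto intro!: derivative_eq_intros simp: flat_exp_def field_simps power2_eq_square)
    moreover have "\<forall>\<^sub>F y in nhds x. poly p (1 / y) * exp (- (1 / y)) = flat_exp p y"
      using eventually_nhds_in_open[of "{0<..}" x] 3
      by (auto simp: flat_exp_def elim: eventually_mono)
    ultimately show ?thesis by (subst DERIV_cong_ev[OF refl _ refl, symmetric])
  qed
qed

lemma smooth_flat_exp: "smooth (flat_exp p)"
proof (rule smooth_coinduct[where P = "\<lambda>f. \<exists>p. f = flat_exp p"])
  fix f assume "\<exists>p. f = flat_exp p"
  then obtain p where f: "f = flat_exp p" by blast
  have "deriv f = flat_exp ((p - pderiv p) * [:0, 0, 1:])"
    unfolding f by (intro ext DERIV_imp_deriv flat_exp_DERIV)
  then show "(\<forall>x. f differentiable (at x)) \<and> (\<exists>p. deriv f = flat_exp p)"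
    unfolding f using flat_exp_DERIV real_differentiable_def by blast
qed auto

lemma smooth_step_exists:
  obtains S where "smooth S" "\<And>x. 0 \<le> deriv S x" "\<And>x. x \<le> 0 \<or> x \<ge> 1 \<Longrightarrow> deriv S x = 0"
    "\<And>x. x \<le> 0 \<Longrightarrow> S x = 0" "\<And>x. x \<ge> 1 \<Longrightarrow> S x = 1"
proof -
  \<comment> \<open>A bump that is positive exactly on the open unit interval. The step is its
    normalised antiderivative, and positivity makes the normalising factor \<open>F 1 - F 0\<close>
    nonzero.\<close>
  define b where "b x = flat_exp 1 x * flat_exp 1 (1 - x)" for x
  have "smooth (\<lambda>x. 1 * flat_exp 1 ((-1) * x + 1))"
    by (intro smooth_affine smooth_flat_exp)
  then have sb: "smooth b"
    unfolding b_def by (intro smooth_mult smooth_flat_exp) simp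
  have b0: "b x \<ge> 0" for x by (simp add: b_def flat_exp_def)
  have bz: "b x = 0" if "x \<le> 0 \<or> x \<ge> 1" for x using that by (auto simp: b_def flat_exp_def)
  have bpos: "b x > 0" if "0 < x" "x < 1" for x using that by (simp add: b_def flat_exp_def)
  have "\<exists>F. \<forall>x::real. -\<infinity> < ereal x \<longrightarrow> ereal x < \<infinity> \<longrightarrow> (F has_vector_derivative b x) (at x)"
    using smooth_continuous_on[OF sb, of UNIV] 
    by (intro einterval_antiderivative) (auto simp: continuous_on_eq_continuous_at)
  then obtain F where F: "\<And>x. (F has_real_derivative b x) (at x)"
    by (auto simp: has_real_derivative_iff_has_vector_derivative)
  have F01: "F 0 < F 1"
    by (rule DERIV_pos_imp_increasing_open) (use F bpos in \<open>auto intro: DERIV_isCont continuous_at_imp_continuous_on\<close>)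
  define S where "S x = (F x - F 0) / (F 1 - F 0)" for x
  have DS: "(S has_real_derivative b x / (F 1 - F 0)) (at x)" for x
    unfolding S_def using DERIV_diff[OF F DERIV_const] by (intro DERIV_cdivide) auto
  have "smooth (\<lambda>x. (1 / (F 1 - F 0)) * b (1 * x + 0))"
    by (intro smooth_affine sb)
  then have "smooth (\<lambda>x. b x / (F 1 - F 0))" by simp
  with smooth_antiderivative[OF DS] have "smooth S" by blast
  moreover have "deriv S x \<ge> 0" for x
    using DERIV_imp_deriv[OF DS] b0 F01 by simp
  moreover have "deriv S x = 0" if "x \<le> 0 \<or> x \<ge> 1" for x
    using DERIV_imp_deriv[OF DS] bz[OF that] by simp
  moreover have "S x = 0" if "x \<le> 0" for x
  proof (cases "x = 0")
    case False
    have "F 0 = F x" if "x < 0" for x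
      by (rule DERIV_isconst_end)
         (use that F bz in \<open>auto intro!: DERIV_isCont continuous_at_imp_continuous_on, metis order.strict_implies_order\<close>)
    from this[of x] show ?thesis using that False by (simp add: S_def)
  qed (simp add: S_def)
  moreover have "S x = 1" if "x \<ge> 1" for x
  proof (cases "x = 1")
    case False
    have "F x = F 1" if "x > 1" for x
      by (rule DERIV_isconst_end)
         (use that F bz in \<open>auto intro!: DERIV_isCont continuous_at_imp_continuous_on, metis order.strict_implies_order\<close>)
    from this[of x] show ?thesis using that False F01 by (simp add: S_def)
  qed (use F01 in \<open>simp add: S_def\<close>)
  ultimately show ?thesis using that by blast
qed

subsection \<open>Weak derivatives of continuous functions\<close>

lemma test_function_iff:
  "test_function \<phi> \<longleftrightarrow> smooth \<phi> \<and> (\<exists>K. compact K \<and> K \<subseteq> {0<..<1} \<and> (\<forall>x. x \<notin> K \<longrightarrow> \<phi> x = 0))"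
  unfolding test_function_def smooth_def by blast

lemma borel_measurable_lebesgueI:
  "f \<in> borel_measurable borel \<Longrightarrow> f \<in> borel_measurable lebesgue"
  by (rule measurable_completion) simp

lemma borel_measurable_lebesgue_onI:
  "f \<in> borel_measurable borel \<Longrightarrow> f \<in> borel_measurable (lebesgue_on A)"
  by (rule measurable_restrict_space1[OF borel_measurable_lebesgueI])

lemma locally_integrable_interval:
  assumes "locally_integrable g" "0 < a" "b < 1"
  shows "g absolutely_integrable_on {a..b}"
proof -
  have "compact {a..b} \<and> {a..b} \<subseteq> {0<..<1}" using assms by auto
  then show ?thesis using assms(1) unfolding locally_integrable_def by blast
qed

text \<open>The kernel \<open>n * S'(n * (x - a))\<close> is a one-sided approximate identity:
  nonnegative, supported in \<open>[a, a + 1 / n]\<close> and of total mass 1.\<close>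

lemma mollify_tendsto:
  assumes S: "smooth S" "\<And>x. 0 \<le> deriv S x" "\<And>x. x \<le> 0 \<or> x \<ge> 1 \<Longrightarrow> deriv S x = 0"
    "\<And>x. x \<le> 0 \<Longrightarrow> S x = 0" "\<And>x. x \<ge> 1 \<Longrightarrow> S x = 1"
    and u: "continuous_on {0..1} u" and a: "0 < a" "a < (1::real)"
  shows "(\<lambda>n. integral {0..1} (\<lambda>x. u x * (real n * deriv S (real n * (x - a))))) \<longlonglongrightarrow> u a"
proof (rule LIMSEQ_I)
  fix r :: real assume r: "r > 0"
  have "\<exists>d>0. \<forall>x\<in>{0..1}. dist x a < d \<longrightarrow> dist (u x) (u a) < r / 2"
    using u[unfolded continuous_on_iff, rule_format, of a "r / 2"] a r by simp
  then obtain d where d: "d > 0" "\<And>x. x \<in> {0..1} \<Longrightarrow> \<bar>x - a\<bar> < d \<Longrightarrow> \<bar>u x - u a\<bar> < r / 2"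
    by (auto simp: dist_real_def)
  \<comment> \<open>For such indices the support of the kernel stays within distance
    \<open>d\<close> of \<open>a\<close> and to the left of 1, so its full mass lies inside the unit
    interval.\<close>
  obtain m :: nat where m: "1 / min d (1 - a) < real m" using reals_Archimedean2 by blast
  show "\<exists>no. \<forall>n\<ge>no. norm (integral {0..1} (\<lambda>x. u x * (real n * deriv S (real n * (x - a)))) - u a) < r"
  proof (intro exI allI impI)
    fix n assume "n \<ge> m"
    then have n: "1 / min d (1 - a) < real n" using m by linarith
    have n0: "real n > 0" using n d a by (smt (verit) divide_nonneg_pos min_def)
    have nd: "1 < real n * d" "1 < real n * (1 - a)"
    proof -
      have "1 < real n * min d (1 - a)" using n d a by (simp add: field_simps)
      also have "real n * min d (1 - a) \<le> real n * d" using n0 by (intro mult_left_mono) auto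
      finally show "1 < real n * d" .
      have "1 < real n * min d (1 - a)" using n d a by (simp add: field_simps)
      also have "real n * min d (1 - a) \<le> real n * (1 - a)" using n0 by (intro mult_left_mono) auto
      finally show "1 < real n * (1 - a)" .
    qed
    define e where "e x = real n * deriv S (real n * (x - a))" for x
    have De: "((\<lambda>x. S (real n * (x - a))) has_real_derivative e x) (at x within A)" for x A
    proof -
      have "(S has_real_derivative deriv S (real n * (x - a))) (at (real n * (x - a)))"
        by (rule smooth_DERIV[OF S(1)])
      then have "((\<lambda>x. S (real n * (x - a))) has_real_derivative deriv S (real n * (x - a)) * real n) (at x within A)"
        by (rule DERIV_chain2[where g = "\<lambda>x. real n * (x - a)"]) (auto intro!: derivative_eq_intros)
      then show ?thesis by (simp add: e_def mult.commute)
    qed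
    have "(e has_integral (S (real n * (1 - a)) - S (real n * (0 - a)))) {0..1}"
      by (rule fundamental_theorem_of_calculus)
         (use De in \<open>auto simp flip: has_real_derivative_iff_has_vector_derivative\<close>)
    moreover have "S (real n * (1 - a)) = 1" using nd by (intro S) auto
    moreover have "S (real n * (0 - a)) = 0" using n0 a by (intro S) auto
    ultimately have e1: "(e has_integral 1) {0..1}" by simp
    have ce: "continuous_on A e" for A
      unfolding e_def
      by (intro continuous_intros smooth_continuous_on_compose[OF smooth_deriv[OF S(1)]])
    have iu: "(\<lambda>x. u x * e x) integrable_on {0..1}"
      by (intro integrable_continuous_real continuous_intros u ce)
    have "((\<lambda>x. u x * e x - u a * e x) has_integral (integral {0..1} (\<lambda>x. u x * e x) - u a * 1)) {0..1}"
      by (intro has_integral_diff has_integral_mult_right e1 integrable_integral iu)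
    then have eq: "integral {0..1} (\<lambda>x. u x * e x) - u a = integral {0..1} (\<lambda>x. u x * e x - u a * e x)"
      by (simp add: integral_unique)
    have "norm (integral {0..1} (\<lambda>x. u x * e x - u a * e x)) \<le> integral {0..1} (\<lambda>x. r / 2 * e x)"
    proof (rule integral_norm_bound_integral)
      show "(\<lambda>x. u x * e x - u a * e x) integrable_on {0..1}"
        by (intro integrable_continuous_real continuous_intros u ce)
      show "(\<lambda>x. r / 2 * e x) integrable_on {0..1}"
        by (intro integrable_continuous_real continuous_intros ce)
      fix x :: real assume x: "x \<in> {0..1}"
      have e0: "e x \<ge> 0" unfolding e_def using n0 S(2) by simp
      show "norm (u x * e x - u a * e x) \<le> r / 2 * e x"
      proof (cases "0 < real n * (x - a) \<and> real n * (x - a) < 1")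
        case True
        then have "x - a > 0" using n0 by (simp add: zero_less_mult_iff)
        moreover have "real n * (x - a) < real n * d" using True nd by linarith
        then have "x - a < d" using n0 by simp
        ultimately have "\<bar>u x - u a\<bar> < r / 2" using d x by auto
        then have "\<bar>u x - u a\<bar> * e x \<le> r / 2 * e x" using e0 by (intro mult_right_mono) auto
        then show ?thesis using e0 by (simp add: abs_mult left_diff_distrib[symmetric])
      next
        case False
        then have "e x = 0" unfolding e_def using S(3) by auto
        then show ?thesis by simp
      qed
    qed
    also have "\<dots> = r / 2" using e1 by (simp add: integral_unique)
    finally show "norm (integral {0..1} (\<lambda>x. u x * (real n * deriv S (real n * (x - a)))) - u a) < r"
      using eq r unfolding e_def by simp
  qed
qed

lemma integral_unit_measure_eq:
  fixes f :: "real \<Rightarrow> real"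
  assumes "integrable unit_measure f"
  shows "(\<integral>x. f x \<partial>unit_measure) = integral {0..1} f"
  using lebesgue_integral_eq_integral[OF assms] by (simp add: integral_open_interval_real)

lemma integrable_unit_measure_continuous:
  fixes f :: "real \<Rightarrow> real"
  assumes "continuous_on {0..1} f"
  shows "integrable unit_measure f"
proof -
  have "integrable (lebesgue_on {0..1}) f"
    using continuous_imp_integrable_real assms by blast
  then have "f absolutely_integrable_on {0..1}"
    by (simp add: set_integrable_def integrable_restrict_space)
  then have "f absolutely_integrable_on {0<..<1}"
    by (rule set_integrable_subset) auto
  then show ?thesis by (simp add: set_integrable_def integrable_restrict_space)
qed

text \<open>The weak identity is tested with the difference of two steepening steps placed at
  \<open>a\<close> and \<open>b\<close>. This difference tends to the indicator of
  \<open>{a<..b}\<close>, while its derivative is a difference of approximate identities that sends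
  \<open>u\<close> to \<open>u a - u b\<close>. The endpoints stay inside the open interval because
  \<open>is_weak_deriv\<close> only provides local integrability of \<open>g\<close>.\<close>

lemma weak_deriv_FTC:
  assumes u: "continuous_on {0..1} u" and w: "is_weak_deriv u g" and ab: "0 < a" "a \<le> b" "b < 1"
  shows "(g has_integral (u b - u a)) {a..b}"
proof -
  obtain S where S: "smooth S" "\<And>x. 0 \<le> deriv S x" "\<And>x. x \<le> 0 \<or> x \<ge> 1 \<Longrightarrow> deriv S x = 0"
    "\<And>x. x \<le> 0 \<Longrightarrow> S x = 0" "\<And>x. x \<ge> 1 \<Longrightarrow> S x = 1"
    using smooth_step_exists by metis
  have mono: "S x \<le> S y" if "x \<le> y" for x y
    using that S(2) smooth_DERIV[OF S(1)] DERIV_nonneg_imp_nondecreasing by blast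
  have S01: "0 \<le> S x" "S x \<le> 1" for x
    using mono[of "min x 0" x] mono[of x "max x 1"] S(4)[of "min x 0"] S(5)[of "max x 1"] by auto
  \<comment> \<open>The test function leaks to the right of \<open>b\<close> by
    \<open>1 / n\<close>. The midpoint of \<open>b\<close> and 1 leaves room for this leak within a
    compact set on which \<open>g\<close> is integrable.\<close>
  define k where "k = (1 + b) / 2"
  have k: "b < k" "k < 1" using ab by (auto simp: k_def)
  define \<phi> where "\<phi> n x = S (real n * (x - a)) - S (real n * (x - b))" for n x
  define e where "e c n x = real n * deriv S (real n * (x - c))" for c n x
  have sS: "smooth (\<lambda>x. c * S (real n * (x - d)))" for n c d
    using smooth_affine[OF S(1), of c "real n" "- real n * d"] by (simp add: algebra_simps)
  have s\<phi>: "smooth (\<phi> n)" for n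
    using smooth_add[OF sS[of 1 n a] sS[of "-1" n b]] by (simp add: \<phi>_def[abs_def])
  have DS: "((\<lambda>x. S (real n * (x - c))) has_real_derivative e c n x) (at x)" for x n c
  proof -
    have "(S has_real_derivative deriv S (real n * (x - c))) (at (real n * (x - c)))"
      by (rule smooth_DERIV[OF S(1)])
    then have "((\<lambda>x. S (real n * (x - c))) has_real_derivative deriv S (real n * (x - c)) * real n) (at x)"
      by (rule DERIV_chain2[where g = "\<lambda>x. real n * (x - c)"]) (auto intro!: derivative_eq_intros)
    then show ?thesis by (simp add: e_def mult.commute)
  qed
  have d\<phi>: "deriv (\<phi> n) x = e a n x - e b n x" for n x
    unfolding \<phi>_def[abs_def] by (intro DERIV_imp_deriv DERIV_diff DS)
  have ce: "continuous_on A (e c n)" for A c n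
    unfolding e_def
    by (intro continuous_intros smooth_continuous_on_compose[OF smooth_deriv[OF S(1)]])
  have "g absolutely_integrable_on {a..k}"
    using w ab k unfolding is_weak_deriv_def by (intro locally_integrable_interval) auto
  then have hint: "integrable lebesgue (\<lambda>x. indicator {a..k} x * g x)"
    by (simp add: set_integrable_def)
  define h where "h x = indicator {a..k} x * g x" for x
  obtain n0 :: nat where n0: "1 / (k - b) < real n0" using reals_Archimedean2 by blast
  have supp: "\<phi> n x = 0" if "x \<notin> {a..k}" "n \<ge> n0" for n x
  proof (cases "x < a")
    case True
    then show ?thesis unfolding \<phi>_def using ab
      by (subst S(4), simp add: mult_nonneg_nonpos, subst S(4)) (auto simp: mult_nonneg_nonpos)
  next
    case False
    then have x: "x > k" using that by auto
    have "1 / (k - b) < real n" using n0 that by linarith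
    then have "1 < real n * (k - b)" using k by (simp add: field_simps)
    also have "\<dots> \<le> real n * (x - b)" using x by (intro mult_left_mono) auto
    finally have 1: "1 < real n * (x - b)" .
    also have "\<dots> \<le> real n * (x - a)" using ab by (intro mult_left_mono) auto
    finally have 2: "1 < real n * (x - a)" .
    show ?thesis unfolding \<phi>_def using 1 2 by (simp add: S(5))
  qed
  have test: "test_function (\<phi> n)" if "n \<ge> n0" for n
    unfolding test_function_iff using s\<phi> supp[OF _ that] ab k by (intro conjI exI[of _ "{a..k}"]) auto
  have lim1: "(\<lambda>n. \<integral>x. h x * \<phi> n x \<partial>lebesgue) \<longlonglongrightarrow> (\<integral>x. h x * indicator {a<..b} x \<partial>lebesgue)"
  proof (rule integral_dominated_convergence[where w = "\<lambda>x. \<bar>h x\<bar>"])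
    have hm: "h \<in> borel_measurable lebesgue" using hint unfolding h_def by auto
    then show "(\<lambda>x. h x * indicator {a<..b} x) \<in> borel_measurable lebesgue"
      by (intro borel_measurable_times borel_measurable_indicator) auto
    show "(\<lambda>x. h x * \<phi> n x) \<in> borel_measurable lebesgue" for n
    proof (intro borel_measurable_times hm)
      have "\<phi> n \<in> borel_measurable borel"
        by (intro borel_measurable_continuous_onI smooth_continuous_on s\<phi>)
      then show "\<phi> n \<in> borel_measurable lebesgue" by (rule borel_measurable_lebesgueI)
    qed
    show "integrable lebesgue (\<lambda>x. \<bar>h x\<bar>)" using hint unfolding h_def by auto
    show "AE x in lebesgue. norm (h x * \<phi> n x) \<le> \<bar>h x\<bar>" for n
    proof (intro AE_I2)
      fix x
      have "\<bar>\<phi> n x\<bar> \<le> 1" unfolding \<phi>_def using S01[of "real n * (x - a)"] S01[of "real n * (x - b)"] by linarith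
      then show "norm (h x * \<phi> n x) \<le> \<bar>h x\<bar>" by (simp add: abs_mult mult_left_le)
    qed
    have ev: "\<forall>\<^sub>F n in sequentially. S (real n * (x - c)) = 1" if "x > c" for x c
    proof -
      obtain m :: nat where m: "1 / (x - c) < real m" using reals_Archimedean2 by blast
      show ?thesis
      proof (rule eventually_sequentiallyI[of m])
        fix n assume "n \<ge> m"
        then have "1 / (x - c) < real n" using m by linarith
        then show "S (real n * (x - c)) = 1" using that by (intro S(5)) (simp add: field_simps)
      qed
    qed
    \<comment> \<open>The limit is half-open because \<open>S 0 = 0\<close>: at \<open>x = a\<close>
      both steps vanish, at \<open>x = b\<close> only the second does.\<close>
    have "(\<lambda>n. \<phi> n x) \<longlonglongrightarrow> indicator {a<..b} x" for x
    proof (rule tendsto_eventually)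
      consider "x \<le> a" | "a < x" "x \<le> b" | "b < x" by linarith
      then show "\<forall>\<^sub>F n in sequentially. \<phi> n x = indicator {a<..b} x"
      proof cases
        case 1
        then have "\<phi> n x = 0" for n unfolding \<phi>_def using ab by (simp add: S(4) mult_nonneg_nonpos)
        then show ?thesis using 1 by simp
      next
        case 2
        then have "S (real n * (x - b)) = 0" for n by (simp add: S(4) mult_nonneg_nonpos)
        then show ?thesis using ev[OF 2(1)] 2 by (auto simp: \<phi>_def)
      next
        case 3
        then show ?thesis using ev[OF 3] ev[of a x] ab by (auto simp: \<phi>_def elim: eventually_elim2)
      qed
    qed
    then show "AE x in lebesgue. (\<lambda>n. h x * \<phi> n x) \<longlonglongrightarrow> h x * indicator {a<..b} x"
      by (intro AE_I2 tendsto_mult_left)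
  qed
  have lim2: "(\<lambda>n. integral {0..1} (\<lambda>x. u x * e a n x) - integral {0..1} (\<lambda>x. u x * e b n x)) \<longlonglongrightarrow> u a - u b"
    unfolding e_def by (intro tendsto_diff mollify_tendsto S u) (use ab in auto)
  have "\<forall>\<^sub>F n in sequentially. integral {0..1} (\<lambda>x. u x * e a n x) - integral {0..1} (\<lambda>x. u x * e b n x)
      = - (\<integral>x. h x * \<phi> n x \<partial>lebesgue)"
  proof (rule eventually_sequentiallyI[of n0])
    fix n assume n: "n \<ge> n0"
    have iu: "integrable unit_measure (\<lambda>x. u x * e c n x)" for c
      by (intro integrable_unit_measure_continuous continuous_intros u ce)
    have "(\<integral>x. u x * deriv (\<phi> n) x \<partial>unit_measure) = - (\<integral>x. g x * \<phi> n x \<partial>unit_measure)"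
      using w test[OF n] unfolding is_weak_deriv_def by blast
    moreover have "(\<integral>x. u x * deriv (\<phi> n) x \<partial>unit_measure)
        = integral {0..1} (\<lambda>x. u x * e a n x) - integral {0..1} (\<lambda>x. u x * e b n x)"
      using iu by (simp add: d\<phi> right_diff_distrib integral_unit_measure_eq)
    moreover have "(\<integral>x. g x * \<phi> n x \<partial>unit_measure) = (\<integral>x. h x * \<phi> n x \<partial>lebesgue)"
      unfolding h_def
      by (subst integral_restrict_space)
         (use supp[OF _ n] ab k in \<open>auto intro!: Bochner_Integration.integral_cong simp: indicator_def\<close>)
    ultimately show "integral {0..1} (\<lambda>x. u x * e a n x) - integral {0..1} (\<lambda>x. u x * e b n x)
        = - (\<integral>x. h x * \<phi> n x \<partial>lebesgue)" by simp
  qed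
  from Lim_transform_eventually[OF lim2 this]
  have "(\<lambda>n. - (\<integral>x. h x * \<phi> n x \<partial>lebesgue)) \<longlonglongrightarrow> u a - u b" .
  with tendsto_minus[OF lim1] have eq: "(\<integral>x. h x * indicator {a<..b} x \<partial>lebesgue) = u b - u a"
    using LIMSEQ_unique by fastforce
  have gi: "g absolutely_integrable_on {a..b}"
    using w ab unfolding is_weak_deriv_def by (intro locally_integrable_interval) auto
  have "(\<integral>x. h x * indicator {a<..b} x \<partial>lebesgue) = (\<integral>x\<in>{a<..b}. g x \<partial>lebesgue)"
    unfolding h_def set_lebesgue_integral_def using k
    by (intro Bochner_Integration.integral_cong) (auto simp: indicator_def)
  also have "\<dots> = integral {a<..b} g"
    by (rule set_lebesgue_integral_eq_integral(2), rule set_integrable_subset[OF gi]) auto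
  also have "\<dots> = integral {a..b} g"
    by (rule integral_subset_negligible[symmetric] integral_subset_negligible)
       (use ab in \<open>auto intro: negligible_subset[OF negligible_sing, of _ a]\<close>)
  finally have "integral {a..b} g = u b - u a" using eq by simp
  moreover have "g integrable_on {a..b}" using gi set_lebesgue_integral_eq_integral(1) by blast
  ultimately show ?thesis using integrable_integral by metis
qed


section \<open>Uniqueness of the weak derivative and its computation for piecewise differentiable
  functions\<close>

lemma locally_integrable_measurable:
  assumes "locally_integrable g"
  shows "g \<in> borel_measurable unit_measure"
proof -
  have "(\<lambda>x. indicator {0<..<1} x * g x) \<in> borel_measurable lebesgue"
  proof (rule borel_measurable_LIMSEQ_real)
    fix n :: nat
    show "(\<lambda>x. indicator {1 / real (Suc n)..1 - 1 / real (Suc n)} x * g x) \<in> borel_measurable lebesgue"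
      using locally_integrable_interval[OF assms, of "1 / real (Suc n)" "1 - 1 / real (Suc n)"]
      by (auto simp: set_integrable_def)
  next
    fix x :: real
    have "\<forall>\<^sub>F n in sequentially. x \<in> {1 / real (Suc n)..1 - 1 / real (Suc n)} \<longleftrightarrow> x \<in> {0<..<1}"
    proof (cases "x \<in> {0<..<1}")
      case True
      have "(\<lambda>n. 1 / real (Suc n)) \<longlonglongrightarrow> 0" by (rule LIMSEQ_Suc[OF lim_1_over_n])
      then have "\<forall>\<^sub>F n in sequentially. 1 / real (Suc n) < min x (1 - x)"
        using True by (intro order_tendstoD) auto
      then show ?thesis using True by (auto elim!: eventually_mono)
    next
      case False
      have out: "x \<notin> {1 / real (Suc n)..1 - 1 / real (Suc n)}" for n
        using False
        by (auto simp: not_le) (smt (verit) divide_pos_pos of_nat_0_le_iff)+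
      have "x \<in> {1 / real (Suc n)..1 - 1 / real (Suc n)} \<longleftrightarrow> x \<in> {0<..<1}" for n
        by (simp only: out False)
      then show ?thesis by (rule always_eventually[OF allI])
    qed
    then show "(\<lambda>n. indicator {1 / real (Suc n)..1 - 1 / real (Suc n)} x * g x)
        \<longlonglongrightarrow> indicator {0<..<1} x * g x"
      by (intro tendsto_eventually) (auto elim!: eventually_mono simp: indicator_def)
  qed
  then show ?thesis by (simp add: borel_measurable_restrict_space_iff mult.commute)
qed

text \<open>Two weak derivatives have the same integral over every compact subinterval, namely the
  increment of \<open>u\<close>. Lebesgue differentiation of the integral of their difference then
  shows that it vanishes off a null set.\<close>

lemma weak_deriv_unique:
  assumes u: "continuous_on {0..1} u" and w: "is_weak_deriv u g1" "is_weak_deriv u g2"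
  shows "AE x in unit_measure. g1 x = g2 x"
proof -
  define K where "K n = {1 / real (Suc n)..1 - 1 / real (Suc n)}" for n
  have "\<exists>Z. negligible Z \<and> (\<forall>x\<in>interior (K n) - Z. g1 x = g2 x)" for n
  proof -
    \<comment> \<open>Truncation to a compact interval makes the difference integrable on the whole
      line, as the differentiation theorem requires; countably many such intervals exhaust the unit
      interval.\<close>
    define f where "f x = (if x \<in> K n then g1 x - g2 x else 0)" for x
    have "(\<lambda>x. g1 x - g2 x) absolutely_integrable_on K n"
      unfolding K_def
      by (intro set_integral_diff locally_integrable_interval) (use w in \<open>auto simp: is_weak_deriv_def\<close>)
    then have "f absolutely_integrable_on UNIV"
      unfolding f_def[abs_def] by (simp only: absolutely_integrable_restrict_UNIV)
    then have "f integrable_on cbox a b" for a b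
      using set_integrable_subset[of lebesgue UNIV f "cbox a b"] set_lebesgue_integral_eq_integral(1) by auto
    then obtain Z where Z: "negligible Z"
      "\<And>x e. x \<notin> Z \<Longrightarrow> 0 < e \<Longrightarrow> \<exists>d>0. \<forall>h. 0 < h \<and> h < d \<longrightarrow>
          norm (integral (cbox x (x + h *\<^sub>R One)) f /\<^sub>R h ^ DIM(real) - f x) < e"
      using integrable_ccontinuous_explicit[of f] by blast
    have "g1 x = g2 x" if x: "x \<in> interior (K n)" "x \<notin> Z" for x
    proof (rule ccontr)
      assume neq: "g1 x \<noteq> g2 x"
      have x': "1 / real (Suc n) < x" "x < 1 - 1 / real (Suc n)"
        using x(1) by (auto simp: K_def)
      obtain d where d: "d > 0" "\<And>h. 0 < h \<Longrightarrow> h < d \<Longrightarrow>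
          norm (integral {x..x + h} f / h - f x) < \<bar>g1 x - g2 x\<bar>"
        using Z(2)[OF x(2), of "\<bar>g1 x - g2 x\<bar>"] neq by (auto simp: divide_inverse mult.commute)
      define h where "h = min (d / 2) (1 - 1 / real (Suc n) - x)"
      have h: "0 < h" "h < d" "x + h \<le> 1 - 1 / real (Suc n)" using d x' by (auto simp: h_def)
      have 0: "0 < x" "x + h < 1"
      proof -
        have "1 / real (Suc n) > 0" by simp
        then show "0 < x" "x + h < 1" using x' h by linarith+
      qed
      have "((\<lambda>t. g1 t - g2 t) has_integral (u (x + h) - u x) - (u (x + h) - u x)) {x..x + h}"
        by (intro has_integral_diff weak_deriv_FTC[OF u w(1)] weak_deriv_FTC[OF u w(2)]) (use 0 h in auto)
      moreover have "integral {x..x + h} f = integral {x..x + h} (\<lambda>t. g1 t - g2 t)"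
        by (rule integral_cong) (use h x' in \<open>auto simp: f_def K_def\<close>)
      ultimately have "integral {x..x + h} f = 0" by (simp add: integral_unique)
      moreover have "f x = g1 x - g2 x" using x' by (simp add: f_def K_def)
      ultimately show False using d(2)[OF h(1,2)] by simp
    qed
    then show ?thesis using Z(1) by blast
  qed
  then obtain Z where Z: "\<And>n. negligible (Z n)" "\<And>n x. x \<in> interior (K n) \<Longrightarrow> x \<notin> Z n \<Longrightarrow> g1 x = g2 x"
    by (metis DiffI)
  have "AE x in lebesgue. x \<notin> (\<Union>n. Z n)"
    using negligible_Union_nat[of Z] Z(1) by (intro AE_not_in) (simp add: negligible_iff_null_sets)
  then have "AE x in lebesgue. x \<in> {0<..<1} \<longrightarrow> g1 x = g2 x"
  proof (eventually_elim, intro impI)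
    fix x :: real assume x: "x \<notin> (\<Union>n. Z n)" "x \<in> {0<..<1}"
    have "\<exists>n. 1 / real (Suc n) < min x (1 - x)"
      using x(2) reals_Archimedean[of "min x (1 - x)"] by (auto simp: inverse_eq_divide)
    then obtain n where "1 / real (Suc n) < min x (1 - x)" by blast
    then have "x \<in> interior (K n)" by (simp add: K_def)
    then show "g1 x = g2 x" using x Z(2) by blast
  qed
  then show ?thesis by (simp add: AE_restrict_space_iff)
qed

lemma weak_deriv_is_weak_deriv: "is_weak_deriv u g \<Longrightarrow> is_weak_deriv u (weak_deriv u)"
  unfolding weak_deriv_def by (rule someI[where P = "is_weak_deriv u"])

lemma is_weak_deriv_piecewise:
  assumes u: "continuous_on {0..1} u" and T: "finite T"
    and D: "\<And>x. x \<in> {0<..<1} - T \<Longrightarrow> (u has_real_derivative g x) (at x)"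
    and g: "g \<in> borel_measurable borel" "\<And>x. \<bar>g x\<bar> \<le> B"
  shows "is_weak_deriv u g"
proof -
  have gl: "g \<in> borel_measurable (lebesgue_on A)" for A
    by (rule borel_measurable_lebesgue_onI[OF g(1)])
  have gi: "g absolutely_integrable_on {0..1}"
    by (rule measurable_bounded_by_integrable_imp_absolutely_integrable[where g = "\<lambda>_. B"])
       (use gl[of "{0..1}"] g(2) in \<open>simp_all add: integrable_on_const\<close>)
  have ui: "u absolutely_integrable_on {0..1}"
    by (rule absolutely_integrable_continuous_real[OF u])
  have li: "locally_integrable f" if "f absolutely_integrable_on {0..1}" for f
    unfolding locally_integrable_def
  proof (intro allI impI)
    fix K :: "real set" assume K: "compact K \<and> K \<subseteq> {0<..<1}"
    then have "K \<in> sets lebesgue" using lmeasurable_compact fmeasurableD by blast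
    moreover have "K \<subseteq> {0..1}" using K by auto
    ultimately show "f absolutely_integrable_on K"
      by (rule set_integrable_subset[OF that])
  qed
  have "(\<integral>x. u x * deriv \<phi> x \<partial>unit_measure) = - (\<integral>x. g x * \<phi> x \<partial>unit_measure)" if "test_function \<phi>" for \<phi>
  proof -
    from that have s: "smooth \<phi>" and "\<exists>K. compact K \<and> K \<subseteq> {0<..<1} \<and> (\<forall>x. x \<notin> K \<longrightarrow> \<phi> x = 0)"
      unfolding test_function_iff by (rule conjunct1, rule conjunct2)
    then obtain K where K: "K \<subseteq> {0<..<1}" "\<And>x. x \<notin> K \<Longrightarrow> \<phi> x = 0" by metis
    have "0 \<notin> K" "1 \<notin> K" using K(1) by auto
    then have \<phi>0: "\<phi> 0 = 0" "\<phi> 1 = 0" by (simp_all add: K(2))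
    have c: "continuous_on A \<phi>" "continuous_on A (deriv \<phi>)" for A
      by (rule smooth_continuous_on[OF s]) (rule smooth_continuous_on[OF smooth_deriv[OF s]])
    \<comment> \<open>Integration by parts as the fundamental theorem for \<open>u * \<phi>\<close>,
      with the finite set \<open>T\<close> as exceptional points. The boundary terms vanish because
      0 and 1 lie outside the support of \<open>\<phi>\<close>.\<close>
    have "((\<lambda>x. u x * deriv \<phi> x + g x * \<phi> x) has_integral (u 1 * \<phi> 1 - u 0 * \<phi> 0)) {0..1}"
    proof (rule fundamental_theorem_of_calculus_interior_strong[OF T])
      show "continuous_on {0..1} (\<lambda>x. u x * \<phi> x)" by (intro continuous_intros u c)
      show "((\<lambda>x. u x * \<phi> x) has_vector_derivative u x * deriv \<phi> x + g x * \<phi> x) (at x)"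
        if "x \<in> {0<..<1} - T" for x
        using DERIV_mult'[OF D[OF that] smooth_DERIV[OF s, of x]]
        unfolding has_real_derivative_iff_has_vector_derivative .
    qed simp
    then have I: "((\<lambda>x. u x * deriv \<phi> x + g x * \<phi> x) has_integral 0) {0..1}" using \<phi>0 by simp
    have iu: "integrable unit_measure (\<lambda>x. u x * deriv \<phi> x)"
      by (intro integrable_unit_measure_continuous continuous_intros u c)
    have ig: "integrable unit_measure (\<lambda>x. g x * \<phi> x)"
    proof (rule Bochner_Integration.integrable_bound)
      show "integrable unit_measure (\<lambda>x. B * \<phi> x)"
        by (intro integrable_unit_measure_continuous continuous_intros c)
      have "\<phi> \<in> borel_measurable unit_measure"
        by (rule borel_measurable_integrable[OF integrable_unit_measure_continuous[OF c(1)]])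
      then show "(\<lambda>x. g x * \<phi> x) \<in> borel_measurable unit_measure"
        by (intro borel_measurable_times gl)
      have "\<bar>g x\<bar> \<le> \<bar>B\<bar>" for x using g(2)[of x] by linarith
      then show "AE x in unit_measure. norm (g x * \<phi> x) \<le> norm (B * \<phi> x)"
        by (intro AE_I2) (simp add: abs_mult mult_right_mono)
    qed
    have "(\<integral>x. u x * deriv \<phi> x \<partial>unit_measure) + (\<integral>x. g x * \<phi> x \<partial>unit_measure)
      = (\<integral>x. u x * deriv \<phi> x + g x * \<phi> x \<partial>unit_measure)"
      using iu ig by simp
    also have "\<dots> = integral {0..1} (\<lambda>x. u x * deriv \<phi> x + g x * \<phi> x)"
      by (intro integral_unit_measure_eq Bochner_Integration.integrable_add iu ig)
    also have "\<dots> = 0" using I by (rule integral_unique)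
    finally show ?thesis by simp
  qed
  with li[OF ui] li[OF gi] show ?thesis by (simp add: is_weak_deriv_def)
qed

text \<open>The bridge from an explicit derivative to the chosen \<open>weak_deriv u\<close>: by
  uniqueness the two agree almost everywhere, so integrability and energy can be computed with
  \<open>g\<close>.\<close>

lemma sobolev_piecewise:
  assumes u: "continuous_on {0..1} u" and T: "finite T"
    and D: "\<And>x. x \<in> {0<..<1} - T \<Longrightarrow> (u has_real_derivative g x) (at x)"
    and g: "g \<in> borel_measurable borel" "\<And>x. \<bar>g x\<bar> \<le> B"
  shows "u \<in> sobolev p"
    and "(\<integral>x. \<bar>weak_deriv u x\<bar> ^ p \<partial>unit_measure) = (\<integral>x. \<bar>g x\<bar> ^ p \<partial>unit_measure)"
proof -
  have w: "is_weak_deriv u g" using is_weak_deriv_piecewise assms by blast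
  then have ww: "is_weak_deriv u (weak_deriv u)" by (rule weak_deriv_is_weak_deriv)
  have ae: "AE x in unit_measure. weak_deriv u x = g x" by (rule weak_deriv_unique[OF u ww w])
  have m: "weak_deriv u \<in> borel_measurable unit_measure" "u \<in> borel_measurable unit_measure"
    using ww unfolding is_weak_deriv_def by (auto intro: locally_integrable_measurable)
  have gl: "g \<in> borel_measurable unit_measure"
    by (rule borel_measurable_lebesgue_onI[OF g(1)])
  show "(\<integral>x. \<bar>weak_deriv u x\<bar> ^ p \<partial>unit_measure) = (\<integral>x. \<bar>g x\<bar> ^ p \<partial>unit_measure)"
    by (rule integral_cong_AE) (use m gl ae in \<open>auto elim: eventually_mono\<close>)
  have "integrable unit_measure (\<lambda>x. \<bar>g x\<bar> ^ p)"
  proof (rule Bochner_Integration.integrable_bound)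
    show "integrable unit_measure (\<lambda>x. \<bar>B\<bar> ^ p)"
      by (intro integrable_unit_measure_continuous continuous_intros)
    have "\<bar>g x\<bar> \<le> \<bar>B\<bar>" for x using g(2)[of x] by linarith
    then show "AE x in unit_measure. norm (\<bar>g x\<bar> ^ p) \<le> norm (\<bar>B\<bar> ^ p)"
      by (intro AE_I2) (simp add: power_abs power_mono)
  qed (use gl in auto)
  then have "integrable unit_measure (\<lambda>x. \<bar>weak_deriv u x\<bar> ^ p)"
    by (rule integrable_cong_AE_imp) (use m ae in \<open>auto elim: eventually_mono\<close>)
  moreover have "integrable unit_measure (\<lambda>x. \<bar>u x\<bar> ^ p)"
    by (intro integrable_unit_measure_continuous continuous_intros u)
  ultimately show "u \<in> sobolev p"
    unfolding sobolev_def Lp_def using u w m by blast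
qed

subsection \<open>Weak convergence of the Moser sequence\<close>

lemma integrable_unit_measure_bounded:
  fixes g :: "real \<Rightarrow> real"
  assumes "g \<in> borel_measurable borel" "\<And>x. \<bar>g x\<bar> \<le> B"
  shows "integrable unit_measure g"
proof (rule Bochner_Integration.integrable_bound)
  show "integrable unit_measure (\<lambda>x. B)"
    by (intro integrable_unit_measure_continuous continuous_intros)
  show "g \<in> borel_measurable unit_measure"
    by (rule borel_measurable_lebesgue_onI[OF assms(1)])
  have "\<bar>g x\<bar> \<le> \<bar>B\<bar>" for x using assms(2)[of x] by linarith
  then show "AE x in unit_measure. norm (g x) \<le> norm B" by (intro AE_I2) simp
qed

lemma integral_unit_measure_FTC:
  assumes "continuous_on {0..1} G" "finite T"
    and D: "\<And>x. x \<in> {0<..<1} - T \<Longrightarrow> (G has_real_derivative g x) (at x)"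
    and "g \<in> borel_measurable borel" "\<And>x. \<bar>g x\<bar> \<le> B"
  shows "(\<integral>x. g x \<partial>unit_measure) = G 1 - G 0"
proof -
  have "(g has_integral (G 1 - G 0)) {0..1}"
    by (rule fundamental_theorem_of_calculus_interior_strong[OF assms(2)])
       (use D assms(1) in \<open>auto simp flip: has_real_derivative_iff_has_vector_derivative\<close>)
  then show ?thesis
    using integral_unit_measure_eq[OF integrable_unit_measure_bounded[OF assms(4,5)]] by (simp add: integral_unique)
qed

definition moser_deriv :: "nat \<Rightarrow> nat \<Rightarrow> real \<Rightarrow> real" where
  "moser_deriv N j t = (if t \<le> 1 / real j then real j powr (1 / real N) else 0)"

lemma min_DERIV:
  fixes a x :: real
  assumes "x \<noteq> a"
  shows "((\<lambda>t. min t a) has_real_derivative (if x \<le> a then 1 else 0)) (at x)"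
proof (cases "x < a")
  case True
  have "\<forall>\<^sub>F t in nhds x. min t a = t"
    using eventually_nhds_in_open[of "{..<a}" x] True by (auto elim: eventually_mono)
  then have "((\<lambda>t. min t a) has_real_derivative 1) (at x) \<longleftrightarrow> ((\<lambda>t. t) has_real_derivative 1) (at x)"
    by (intro DERIV_cong_ev refl)
  then show ?thesis using True by simp
next
  case False
  then have x: "x > a" using assms by simp
  have "\<forall>\<^sub>F t in nhds x. min t a = a"
    using eventually_nhds_in_open[of "{a<..}" x] x by (auto elim: eventually_mono)
  then have "((\<lambda>t. min t a) has_real_derivative 0) (at x) \<longleftrightarrow> ((\<lambda>t. a) has_real_derivative 0) (at x)"
    by (intro DERIV_cong_ev refl)
  then show ?thesis using x by simp
qed

context
  fixes N :: nat
  assumes N: "N \<ge> 2"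
begin

text \<open>Since \<open>- (N - 1) / N = 1 / N - 1\<close>, both branches share one factor, and the
  kink is that of \<open>min\<close>.\<close>

lemma moser_eq_min:
  assumes "j \<ge> 1"
  shows "moser N j t = real j powr (1 / real N) * min t (1 / real j)"
proof -
  have "real j powr (- ((real N - 1) / real N)) = real j powr (1 / real N - 1)"
    using N by (intro arg_cong2[where f = "(powr)"] refl) (simp add: field_simps)
  also have "\<dots> = real j powr (1 / real N) * (1 / real j)"
    using assms by (simp add: powr_diff)
  finally show ?thesis by (simp add: moser_def)
qed

lemma moser_continuous: "j \<ge> 1 \<Longrightarrow> continuous_on A (moser N j)"
  using continuous_on_cong[OF refl moser_eq_min[of j], of A]
  by (auto intro!: continuous_intros)

lemma moser_DERIV:
  assumes "j \<ge> 1" "x \<noteq> 1 / real j"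
  shows "(moser N j has_real_derivative moser_deriv N j x) (at x)"
proof -
  have "moser N j = (\<lambda>t. real j powr (1 / real N) * min t (1 / real j))"
    using moser_eq_min[OF assms(1)] by blast
  then show ?thesis
    using DERIV_cmult[OF min_DERIV[OF assms(2)], of "real j powr (1 / real N)"]
    by (simp add: moser_deriv_def split: if_splits)
qed

lemma moser_deriv_measurable: "moser_deriv N j \<in> borel_measurable borel"
  unfolding moser_deriv_def by measurable

lemma moser_deriv_nonneg: "0 \<le> moser_deriv N j x"
  by (simp add: moser_deriv_def)

lemma moser_deriv_bound: "moser_deriv N j x \<le> real j powr (1 / real N)"
  by (simp add: moser_deriv_def)

lemma powr_inverse_power:
  fixes x :: real
  assumes "x \<ge> 0"
  shows "(x powr (1 / real N)) ^ N = x"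
proof (cases "x = 0")
  case False
  then have "(x powr (1 / real N)) ^ N = (x powr (1 / real N)) powr real N"
    using assms by (intro powr_realpow[symmetric]) simp
  also have "\<dots> = x" using N assms False by (simp add: powr_powr)
  finally show ?thesis .
qed (use N in simp)

lemma moser_deriv_power: "moser_deriv N j x ^ N = (if x \<le> 1 / real j then real j else 0)"
  using N by (simp add: moser_deriv_def powr_inverse_power)

text \<open>Stated for finite sums so that one computation serves the zero function (empty sum), a
  single Moser function, and the signed sums used against a functional.\<close>

lemma moser_sum_sobolev:
  assumes A: "finite A" "\<And>k. k \<in> A \<Longrightarrow> q k \<ge> 1"
  shows "(\<lambda>x. \<Sum>k\<in>A. a k * moser N (q k) x) \<in> sobolev p"
    and "(\<integral>x. \<bar>weak_deriv (\<lambda>x. \<Sum>k\<in>A. a k * moser N (q k) x) x\<bar> ^ p \<partial>unit_measure)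
       = (\<integral>x. \<bar>\<Sum>k\<in>A. a k * moser_deriv N (q k) x\<bar> ^ p \<partial>unit_measure)"
proof -
  have 1: "continuous_on {0..1} (\<lambda>x. \<Sum>k\<in>A. a k * moser N (q k) x)"
    by (intro continuous_intros moser_continuous A)
  have 2: "finite ((\<lambda>k. 1 / real (q k)) ` A)" using A by simp
  have 3: "((\<lambda>x. \<Sum>k\<in>A. a k * moser N (q k) x) has_real_derivative (\<Sum>k\<in>A. a k * moser_deriv N (q k) x)) (at x)"
    if "x \<in> {0<..<1} - ((\<lambda>k. 1 / real (q k)) ` A)" for x
    by (intro DERIV_sum DERIV_cmult moser_DERIV A) (use that in auto)
  have 4: "(\<lambda>x. \<Sum>k\<in>A. a k * moser_deriv N (q k) x) \<in> borel_measurable borel"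
    by (intro borel_measurable_sum borel_measurable_times borel_measurable_const moser_deriv_measurable)
  have 5: "\<bar>\<Sum>k\<in>A. a k * moser_deriv N (q k) x\<bar> \<le> (\<Sum>k\<in>A. \<bar>a k\<bar> * real (q k) powr (1 / real N))" for x
    by (rule order_trans[OF sum_abs])
       (auto intro!: sum_mono mult_left_mono moser_deriv_bound simp: abs_mult moser_deriv_nonneg)
  show "(\<lambda>x. \<Sum>k\<in>A. a k * moser N (q k) x) \<in> sobolev p"
    and "(\<integral>x. \<bar>weak_deriv (\<lambda>x. \<Sum>k\<in>A. a k * moser N (q k) x) x\<bar> ^ p \<partial>unit_measure)
       = (\<integral>x. \<bar>\<Sum>k\<in>A. a k * moser_deriv N (q k) x\<bar> ^ p \<partial>unit_measure)"
    using sobolev_piecewise[OF 1 2 3 4 5, of p] by simp_all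
qed

lemma zero_in_sobolev: "(\<lambda>_. 0) \<in> sobolev p"
  using moser_sum_sobolev(1)[of "{}"] by simp

lemma integral_moser_deriv_power:
  assumes "j \<ge> 1"
  shows "(\<integral>x. moser_deriv N j x ^ N \<partial>unit_measure) = 1"
proof -
  have "(\<integral>x. moser_deriv N j x ^ N \<partial>unit_measure) = real j * min 1 (1 / real j) - real j * min 0 (1 / real j)"
  proof (rule integral_unit_measure_FTC[where T = "{1 / real j}" and B = "real j"])
    show "continuous_on {0..1} (\<lambda>x. real j * min x (1 / real j))" by (intro continuous_intros)
    show "((\<lambda>x. real j * min x (1 / real j)) has_real_derivative moser_deriv N j x ^ N) (at x)"
      if "x \<in> {0<..<1} - {1 / real j}" for x
      using that DERIV_cmult[OF min_DERIV[of x "1 / real j"], of "real j"]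
      by (simp add: moser_deriv_power split: if_splits)
    show "(\<lambda>x. moser_deriv N j x ^ N) \<in> borel_measurable borel"
      by (intro borel_measurable_power moser_deriv_measurable)
  qed (auto simp: moser_deriv_power)
  also have "\<dots> = 1" using assms by (simp add: min_def)
  finally show ?thesis .
qed

lemma moser_in_E:
  assumes "j \<ge> 1"
  shows "moser N j \<in> E N"
proof -
  have "moser N j 0 = 0" by (simp add: moser_def)
  then show ?thesis
    using moser_sum_sobolev[of "{()}" "\<lambda>_. j" "\<lambda>_. 1" N] assms integral_moser_deriv_power[OF assms]
    by (simp add: E_def moser_deriv_nonneg)
qed

lemma moser_in_sobolev: "j \<ge> 1 \<Longrightarrow> moser N j \<in> sobolev N"
  using moser_in_E unfolding E_def by blast

lemma moser_nonneg: "0 \<le> t \<Longrightarrow> 0 \<le> moser N j t"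
  by (simp add: moser_def)

lemma sobolev_dual_linear:
  assumes "L \<in> sobolev_dual N" "u \<in> sobolev N" "v \<in> sobolev N"
  shows "L (\<lambda>x. a * u x + b * v x) = a * L u + b * L v"
  using assms by (simp add: sobolev_dual_def)

lemma sobolev_dual_sum:
  assumes L: "L \<in> sobolev_dual N" and A: "finite A" "\<And>k. k \<in> A \<Longrightarrow> q k \<ge> 1"
  shows "L (\<lambda>x. \<Sum>k\<in>A. a k * moser N (q k) x) = (\<Sum>k\<in>A. a k * L (moser N (q k)))"
  using A
proof (induction A)
  case empty
  show ?case using sobolev_dual_linear[OF L zero_in_sobolev zero_in_sobolev, of 0 0] by simp
next
  case (insert k A)
  have "L (\<lambda>x. a k * moser N (q k) x + 1 * (\<lambda>x. \<Sum>k\<in>A. a k * moser N (q k) x) x)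
      = a k * L (moser N (q k)) + 1 * L (\<lambda>x. \<Sum>k\<in>A. a k * moser N (q k) x)"
    by (intro sobolev_dual_linear[OF L] moser_sum_sobolev moser_in_sobolev) (use insert in auto)
  then show ?case using insert by simp
qed

text \<open>Along a sparse subsequence the derivatives have almost disjoint supports, so a signed sum of
  \<open>n\<close> of them has norm of order \<open>n\<close> to the power \<open>1 / N\<close>.\<close>

lemma sparse_moser_sum_norm:
  fixes q :: "nat \<Rightarrow> nat" and a :: "nat \<Rightarrow> real"
  assumes q: "\<And>k. q k \<ge> 1" "\<And>k. q (Suc k) \<ge> 2 ^ N * q k" and a: "\<And>k. \<bar>a k\<bar> \<le> 1" and n: "n \<ge> 1"
  shows "sobolev_norm N (\<lambda>x. \<Sum>k<n. a k * moser N (q k) x) ^ N \<le> 2 * 2 ^ N * real n"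
proof -
  define u where "u x = (\<Sum>k<n. a k * moser N (q k) x)" for x
  define c where "c k = real (q k) powr (1 / real N)" for k
  have cN: "c k ^ N = real (q k)" for k by (simp add: c_def powr_inverse_power)
  have c1: "c k \<ge> 1" for k unfolding c_def using q(1)[of k] by (intro ge_one_powr_ge_zero) auto
  \<comment> \<open>The sparsity factor \<open>2 ^ N\<close> is chosen so that the slopes
    \<open>c k\<close>, which are N-th roots of \<open>q k\<close>, at least double; their partial
    sums are then at most twice the last slope.\<close>
  have c2: "2 * c k \<le> c (Suc k)" for k
  proof (rule power_le_imp_le_base)
    have "(2 * c k) ^ Suc (N - 1) = real (2 ^ N * q k)" using N by (simp add: power_mult_distrib cN del: power_Suc)
    also have "\<dots> \<le> real (q (Suc k))" using q(2) of_nat_mono by blast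
    also have "\<dots> = c (Suc k) ^ Suc (N - 1)" using N by (simp add: cN del: power_Suc)
    finally show "(2 * c k) ^ Suc (N - 1) \<le> c (Suc k) ^ Suc (N - 1)" .
    show "0 \<le> c (Suc k)" using c1[of "Suc k"] by linarith
  qed
  have c2k: "2 ^ k \<le> c k" for k
  proof (induction k)
    case (Suc k)
    then show ?case using c2[of k] by simp
  qed (use c1 in simp)
  have csum: "(\<Sum>k\<le>m. c k) \<le> 2 * c m" for m
  proof (induction m)
    case (Suc m)
    then show ?case using c2[of m] by simp
  qed (use c1[of 0] in simp)
  \<comment> \<open>The maximum of the k-th function is \<open>c k / c k ^ N\<close>, which is at
    most \<open>1 / c k\<close> because \<open>N\<close> is at least 2. So the functions themselves
    sum to at most 2, uniformly in \<open>n\<close>.\<close>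
  have mb: "\<bar>moser N (q k) x\<bar> \<le> (1 / 2) ^ k" if "x \<ge> 0" for k x
  proof -
    have "moser N (q k) x \<le> c k * (1 / real (q k))"
      unfolding moser_eq_min[OF q(1)] c_def by (intro mult_left_mono) auto
    also have "\<dots> \<le> 1 / c k"
    proof -
      have "c k ^ 2 \<le> c k ^ N" using N c1[of k] by (intro power_increasing) auto
      then have "c k * c k \<le> real (q k)" by (simp add: cN power2_eq_square)
      then show ?thesis using c1[of k] q(1)[of k] by (simp add: field_simps)
    qed
    also have "\<dots> \<le> 1 / 2 ^ k" using c2k[of k] by (intro divide_left_mono) (use c1[of k] in auto)
    finally show ?thesis using moser_nonneg[OF that] by (simp add: power_one_over)
  qed
  have ub: "\<bar>u x\<bar> \<le> 2" if "x \<ge> 0" for x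
  proof -
    have "\<bar>u x\<bar> \<le> (\<Sum>k<n. (1 / 2) ^ k)"
      unfolding u_def
    proof (rule order_trans[OF sum_abs], rule sum_mono)
      fix k
      have "\<bar>a k\<bar> * \<bar>moser N (q k) x\<bar> \<le> 1 * (1 / 2) ^ k"
        by (intro mult_mono a mb that) auto
      then show "\<bar>a k * moser N (q k) x\<bar> \<le> (1 / 2) ^ k" by (simp add: abs_mult)
    qed
    also have "\<dots> = 2 - 2 * (1 / 2) ^ n" by (induction n) auto
    also have "\<dots> \<le> 2" by simp
    finally show ?thesis .
  qed
  have uc: "continuous_on {0..1} u"
    unfolding u_def by (intro continuous_intros moser_continuous q)
  have "(\<integral>x. \<bar>u x\<bar> ^ N \<partial>unit_measure) \<le> (\<integral>x. 2 ^ N \<partial>unit_measure)"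
    by (rule integral_mono)
       (auto intro!: integrable_unit_measure_continuous continuous_intros uc power_mono ub)
  also have "\<dots> = 2 ^ N"
    by (subst integral_unit_measure_eq) (auto intro!: integrable_unit_measure_continuous continuous_intros)
  finally have I1: "(\<integral>x. \<bar>u x\<bar> ^ N \<partial>unit_measure) \<le> 2 ^ N" .
  \<comment> \<open>Induction on the last index: where the steepest slope is active, the geometric
    bound lets it dominate the whole sum up to a factor 2; elsewhere it is 0 and the induction
    hypothesis applies. This replaces disjointness of supports.\<close>
  have Db: "(\<Sum>k<m. moser_deriv N (q k) x) ^ N \<le> (\<Sum>k<m. 2 ^ N * moser_deriv N (q k) x ^ N)" for m x
  proof (induction m)
    case 0
    then show ?case using N by (simp add: power_0_left)
  next
    case (Suc m)
    show ?case
    proof (cases "x \<le> 1 / real (q m)")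
      case True
      then have m: "moser_deriv N (q m) x = c m" by (simp add: moser_deriv_def c_def)
      have "(\<Sum>k<Suc m. moser_deriv N (q k) x) \<le> (\<Sum>k\<le>m. c k)"
        unfolding lessThan_Suc_atMost by (intro sum_mono) (simp add: c_def moser_deriv_bound)
      then have "(\<Sum>k<Suc m. moser_deriv N (q k) x) \<le> 2 * c m" using csum[of m] by linarith
      then have "(\<Sum>k<Suc m. moser_deriv N (q k) x) ^ N \<le> (2 * c m) ^ N"
        by (intro power_mono sum_nonneg moser_deriv_nonneg)
      also have "\<dots> = 2 ^ N * moser_deriv N (q m) x ^ N" by (simp add: m power_mult_distrib)
      also have "\<dots> \<le> (\<Sum>k<Suc m. 2 ^ N * moser_deriv N (q k) x ^ N)"
        by (intro member_le_sum) (auto simp: moser_deriv_nonneg)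
      finally show ?thesis .
    next
      case False
      then have "moser_deriv N (q m) x = 0" by (simp add: moser_deriv_def)
      then show ?thesis using Suc N by (simp add: power_0_left)
    qed
  qed
  have mp: "integrable unit_measure (\<lambda>x. moser_deriv N (q k) x ^ N)" for k
    by (rule integrable_unit_measure_bounded[where B = "real (q k)"])
       (auto intro!: borel_measurable_power moser_deriv_measurable simp: moser_deriv_power)
  have "(\<integral>x. \<bar>weak_deriv u x\<bar> ^ N \<partial>unit_measure) = (\<integral>x. \<bar>\<Sum>k<n. a k * moser_deriv N (q k) x\<bar> ^ N \<partial>unit_measure)"
    using moser_sum_sobolev(2)[of "{..<n}" q a N] q(1) by (simp add: u_def[abs_def])
  also have "\<dots> \<le> (\<integral>x. (\<Sum>k<n. 2 ^ N * moser_deriv N (q k) x ^ N) \<partial>unit_measure)"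
  proof (rule integral_mono)
    have le: "\<bar>\<Sum>k<n. a k * moser_deriv N (q k) x\<bar> ^ N \<le> (\<Sum>k<n. 2 ^ N * moser_deriv N (q k) x ^ N)" for x
    proof -
      have "\<bar>\<Sum>k<n. a k * moser_deriv N (q k) x\<bar> \<le> (\<Sum>k<n. moser_deriv N (q k) x)"
      proof (rule order_trans[OF sum_abs], rule sum_mono)
        fix k
        have "\<bar>a k\<bar> * moser_deriv N (q k) x \<le> 1 * moser_deriv N (q k) x"
          by (intro mult_right_mono a moser_deriv_nonneg)
        then show "\<bar>a k * moser_deriv N (q k) x\<bar> \<le> moser_deriv N (q k) x"
          by (simp add: abs_mult moser_deriv_nonneg)
      qed
      then have "\<bar>\<Sum>k<n. a k * moser_deriv N (q k) x\<bar> ^ N \<le> (\<Sum>k<n. moser_deriv N (q k) x) ^ N"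
        by (intro power_mono) auto
      then show ?thesis using Db[where m = n and x = x] by linarith
    qed
    then show "\<bar>\<Sum>k<n. a k * moser_deriv N (q k) x\<bar> ^ N \<le> (\<Sum>k<n. 2 ^ N * moser_deriv N (q k) x ^ N)" for x .
    show int: "integrable unit_measure (\<lambda>x. \<Sum>k<n. 2 ^ N * moser_deriv N (q k) x ^ N)"
      by (intro Bochner_Integration.integrable_sum Bochner_Integration.integrable_mult_right mp)
    show "integrable unit_measure (\<lambda>x. \<bar>\<Sum>k<n. a k * moser_deriv N (q k) x\<bar> ^ N)"
    proof (rule Bochner_Integration.integrable_bound[OF int])
      have "(\<lambda>x. \<bar>\<Sum>k<n. a k * moser_deriv N (q k) x\<bar> ^ N) \<in> borel_measurable borel"
        by (intro borel_measurable_power borel_measurable_abs borel_measurable_sum borel_measurable_times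
            borel_measurable_const moser_deriv_measurable)
      then show "(\<lambda>x. \<bar>\<Sum>k<n. a k * moser_deriv N (q k) x\<bar> ^ N) \<in> borel_measurable unit_measure"
        by (rule borel_measurable_lebesgue_onI)
      have "norm (\<bar>\<Sum>k<n. a k * moser_deriv N (q k) x\<bar> ^ N) \<le> norm (\<Sum>k<n. 2 ^ N * moser_deriv N (q k) x ^ N)" for x
        using le[of x] by (simp only: real_norm_def abs_of_nonneg zero_le_power abs_ge_zero)
      then show "AE x in unit_measure. norm (\<bar>\<Sum>k<n. a k * moser_deriv N (q k) x\<bar> ^ N)
          \<le> norm (\<Sum>k<n. 2 ^ N * moser_deriv N (q k) x ^ N)" by (rule AE_I2)
    qed
  qed
  also have "\<dots> = 2 ^ N * real n"
    using mp by (simp add: Bochner_Integration.integral_sum integral_moser_deriv_power[OF q(1)])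
  finally have I2: "(\<integral>x. \<bar>weak_deriv u x\<bar> ^ N \<partial>unit_measure) \<le> 2 ^ N * real n" .
  have "2 ^ N * 1 \<le> 2 ^ N * real n" using n by (intro mult_left_mono) auto
  then have "(\<integral>x. \<bar>u x\<bar> ^ N \<partial>unit_measure) + (\<integral>x. \<bar>weak_deriv u x\<bar> ^ N \<partial>unit_measure) \<le> 2 * 2 ^ N * real n"
    using I1 I2 by linarith
  moreover have "sobolev_norm N u ^ N = (\<integral>x. \<bar>u x\<bar> ^ N \<partial>unit_measure) + (\<integral>x. \<bar>weak_deriv u x\<bar> ^ N \<partial>unit_measure)"
    unfolding sobolev_norm_def
    by (rule real_root_pow_pos2) (use N in \<open>auto intro!: add_nonneg_nonneg integral_nonneg_AE\<close>)
  ultimately show ?thesis by (simp add: u_def[abs_def])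
qed

theorem moser_weakly_converges: "sobolev_weakly_converges N (moser N) (\<lambda>_. 0)"
proof -
  have "(\<lambda>j. L (moser N j)) \<longlonglongrightarrow> L (\<lambda>_. 0)" if L: "L \<in> sobolev_dual N" for L
  proof (rule ccontr)
    assume "\<not> ?thesis"
    moreover have "L (\<lambda>_. 0) = 0" using sobolev_dual_sum[OF L, of "{}"] by simp
    ultimately obtain e where e: "e > 0" "\<And>m. \<exists>j\<ge>m. \<bar>L (moser N j)\<bar> \<ge> e"
      unfolding LIMSEQ_iff by (auto simp: not_less)
    obtain C where C: "\<And>u. u \<in> sobolev N \<Longrightarrow> \<bar>L u\<bar> \<le> C * sobolev_norm N u"
      using L unfolding sobolev_dual_def by blast
    \<comment> \<open>Failure of convergence supplies arbitrarily large indices at which the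
      functional is at least \<open>e\<close> in absolute value, so they can be chosen as sparse as
      the norm estimate demands.\<close>
    have "\<exists>q. \<forall>k. (q k \<ge> 1 \<and> \<bar>L (moser N (q k))\<bar> \<ge> e) \<and> q (Suc k) \<ge> 2 ^ N * q k"
    proof (rule dependent_nat_choice)
      show "\<exists>x. x \<ge> 1 \<and> \<bar>L (moser N x)\<bar> \<ge> e" using e(2)[of 1] by blast
      show "\<exists>y. (y \<ge> 1 \<and> \<bar>L (moser N y)\<bar> \<ge> e) \<and> y \<ge> 2 ^ N * x" for x k :: nat
        using e(2)[of "max 1 (2 ^ N * x)"] by auto
    qed
    then obtain q :: "nat \<Rightarrow> nat" where q: "\<And>k. q k \<ge> 1" "\<And>k. \<bar>L (moser N (q k))\<bar> \<ge> e" "\<And>k. q (Suc k) \<ge> 2 ^ N * q k"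
      by blast
    have "real n * e ^ N \<le> \<bar>C\<bar> ^ N * (2 * 2 ^ N)" if n: "n \<ge> 1" for n :: nat
    proof -
      \<comment> \<open>The signs make all contributions add up, so the functional is at least
        \<open>n * e\<close> on this sum.\<close>
      define u where "u = (\<lambda>x. \<Sum>k<n. sgn (L (moser N (q k))) * moser N (q k) x)"
      have us: "u \<in> sobolev N" unfolding u_def by (rule moser_sum_sobolev) (use q in auto)
      have "real n * e = (\<Sum>k<n. e)" by simp
      also have "\<dots> \<le> (\<Sum>k<n. sgn (L (moser N (q k))) * L (moser N (q k)))"
        by (intro sum_mono) (use q(2) in \<open>simp add: abs_sgn mult.commute\<close>)
      also have "\<dots> = L u" unfolding u_def by (rule sobolev_dual_sum[symmetric, OF L]) (use q in auto)
      also have "\<dots> \<le> \<bar>C\<bar> * sobolev_norm N u"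
      proof -
        have "sobolev_norm N u \<ge> 0"
          unfolding sobolev_norm_def using N by (auto intro!: real_root_ge_zero add_nonneg_nonneg integral_nonneg_AE)
        then have "C * sobolev_norm N u \<le> \<bar>C\<bar> * sobolev_norm N u" by (intro mult_right_mono) auto
        then show ?thesis using C[OF us] by linarith
      qed
      finally have "(real n * e) ^ N \<le> (\<bar>C\<bar> * sobolev_norm N u) ^ N"
        using e by (intro power_mono) auto
      also have "\<dots> = \<bar>C\<bar> ^ N * sobolev_norm N u ^ N" by (rule power_mult_distrib)
      also have "\<dots> \<le> \<bar>C\<bar> ^ N * (2 * 2 ^ N * real n)"
        unfolding u_def by (intro mult_left_mono sparse_moser_sum_norm q n) (auto simp: abs_sgn_eq)
      finally have "real n ^ N * e ^ N \<le> (\<bar>C\<bar> ^ N * (2 * 2 ^ N)) * real n" by (simp add: power_mult_distrib ac_simps)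
      \<comment> \<open>Quadratic growth on the left against linear growth on the right already
        gives the contradiction, which is where \<open>N \<ge> 2\<close> enters.\<close>
      moreover have "real n ^ 2 * e ^ N \<le> real n ^ N * e ^ N"
        using N n e by (intro mult_right_mono power_increasing) auto
      ultimately have "real n * (real n * e ^ N) \<le> real n * (\<bar>C\<bar> ^ N * (2 * 2 ^ N))"
        by (simp add: power2_eq_square ac_simps)
      then show ?thesis using n by simp
    qed
    moreover obtain n :: nat where "\<bar>C\<bar> ^ N * (2 * 2 ^ N) / e ^ N < real n" using reals_Archimedean2 by blast
    then have "\<bar>C\<bar> ^ N * (2 * 2 ^ N) < real n * e ^ N" using e by (simp add: field_simps)
    moreover have "real n * e ^ N \<le> real (max n 1) * e ^ N" using e by (intro mult_right_mono) auto
    ultimately show False by (meson max.cobounded2 not_less order_less_le_trans)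
  qed
  then show ?thesis
    unfolding sobolev_weakly_converges_def using moser_in_sobolev zero_in_sobolev by blast
qed

end

subsection \<open>Localisation of the near-extremal points\<close>

text \<open>Convexity: the tangent of the n-th power at \<open>c\<close> lies below its graph. This
  is Bernoulli's inequality at \<open>(y - c) / c\<close>, which is at least -1.\<close>

lemma power_tangent_le:
  fixes y c :: real
  assumes "0 \<le> y" "0 \<le> c" "n \<ge> 2"
  shows "c ^ n + real n * c ^ (n - 1) * (y - c) \<le> y ^ n"
proof (cases "c = 0")
  case True
  then show ?thesis using assms by (simp add: power_0_left)
next
  case False
  then have c: "c > 0" using assms by simp
  have "1 + real n * ((y - c) / c) \<le> (1 + (y - c) / c) ^ n"
    using assms c by (intro Bernoulli_inequality) (simp add: field_simps)
  also have "1 + (y - c) / c = y / c" using c by (simp add: field_simps)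
  finally have "c ^ n * (1 + real n * ((y - c) / c)) \<le> c ^ n * (y / c) ^ n"
    using c by (intro mult_left_mono) auto
  moreover have "c ^ n * (y / c) ^ n = y ^ n" using c by (simp add: power_divide)
  moreover have "c ^ n * (1 + real n * ((y - c) / c)) = c ^ n + real n * c ^ (n - 1) * (y - c)"
  proof -
    have "c ^ n = c ^ (n - 1) * c" using assms by (cases n) auto
    moreover have "d * c * (1 + m * ((y - c) / c)) = d * c + m * d * (y - c)" for d m :: real
      using c by (simp add: field_simps)
    ultimately show ?thesis by metis
  qed
  ultimately show ?thesis by simp
qed

lemma integral_power_le:
  fixes g :: "real \<Rightarrow> real"
  assumes n: "n \<ge> 2" and ab: "a < b"
    and g: "g absolutely_integrable_on {a..b}" and h: "(\<lambda>x. \<bar>g x\<bar> ^ n) integrable_on {a..b}"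
  shows "\<bar>integral {a..b} g\<bar> ^ n \<le> (b - a) ^ (n - 1) * integral {a..b} (\<lambda>x. \<bar>g x\<bar> ^ n)"
proof -
  define c where "c = \<bar>integral {a..b} g\<bar> / (b - a)"
  have c: "c \<ge> 0" unfolding c_def using ab by simp
  have ag: "(\<lambda>x. \<bar>g x\<bar>) integrable_on {a..b}"
    using g unfolding absolutely_integrable_on_def by simp
  have "\<bar>integral {a..b} g\<bar> \<le> integral {a..b} (\<lambda>x. \<bar>g x\<bar>)"
    using integral_norm_bound_integral[of g "{a..b}" "\<lambda>x. \<bar>g x\<bar>"] ag set_lebesgue_integral_eq_integral(1)[OF g]
    by simp
  then have le: "(b - a) * c \<le> integral {a..b} (\<lambda>x. \<bar>g x\<bar>)" using ab by (simp add: c_def)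
  have ci: "((\<lambda>x. c) has_integral (b - a) * c) {a..b}" for c
    using has_integral_const_real[of c a b] ab by simp
  have "((\<lambda>x. c ^ n + real n * c ^ (n - 1) * (\<bar>g x\<bar> - c)) has_integral
      (b - a) * c ^ n + real n * c ^ (n - 1) * (integral {a..b} (\<lambda>x. \<bar>g x\<bar>) - (b - a) * c)) {a..b}"
    by (intro has_integral_add has_integral_mult_right has_integral_diff ci integrable_integral ag)
  then have "(b - a) * c ^ n + real n * c ^ (n - 1) * (integral {a..b} (\<lambda>x. \<bar>g x\<bar>) - (b - a) * c)
      \<le> integral {a..b} (\<lambda>x. \<bar>g x\<bar> ^ n)"
    by (rule has_integral_le[OF _ integrable_integral[OF h]]) (use power_tangent_le c n in auto)
  moreover have "0 \<le> real n * c ^ (n - 1) * (integral {a..b} (\<lambda>x. \<bar>g x\<bar>) - (b - a) * c)"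
    using le c by (intro mult_nonneg_nonneg) auto
  ultimately have "(b - a) * c ^ n \<le> integral {a..b} (\<lambda>x. \<bar>g x\<bar> ^ n)" by linarith
  then have "(b - a) ^ (n - 1) * ((b - a) * c ^ n) \<le> (b - a) ^ (n - 1) * integral {a..b} (\<lambda>x. \<bar>g x\<bar> ^ n)"
    using ab by (intro mult_left_mono) auto
  moreover have "(b - a) ^ (n - 1) * ((b - a) * c ^ n) = ((b - a) * c) ^ n"
    using n by (cases n) (auto simp: power_mult_distrib)
  moreover have "(b - a) * c = \<bar>integral {a..b} g\<bar>" using ab by (simp add: c_def)
  ultimately show ?thesis by simp
qed

text \<open>The quantity \<open>\<psi>\<close> of the overview. The absolute value keeps it
  nonnegative for odd \<open>N\<close>; the passage from \<open>v ^ N\<close> to it is made in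
  \<open>log_weight_power_le\<close>.\<close>

definition peak_ratio :: "nat \<Rightarrow> (real \<Rightarrow> real) \<Rightarrow> real \<Rightarrow> real" where
  "peak_ratio N v s = \<bar>v s\<bar> ^ N / s ^ (N - 1)"

context
  fixes N :: nat
  assumes N: "N \<ge> 2"
begin

text \<open>Hoelder's inequality on both of the adjacent intervals, whose energies add up to at most
  1: what the first increment spends is missing for the second. The auxiliary point
  \<open>a > 0\<close> is forced by the fundamental theorem being available only inside the open
  interval.\<close>

lemma E_energy_split:
  assumes v: "v \<in> E N" and apq: "0 < a" "a < p" "p < q" "q < 1"
  shows "\<bar>v q - v p\<bar> ^ N \<le> (q - p) ^ (N - 1) * (1 - \<bar>v p - v a\<bar> ^ N / (p - a) ^ (N - 1))"
    and "\<bar>v p - v a\<bar> ^ N \<le> (p - a) ^ (N - 1)"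
proof -
  define g where "g = weak_deriv v"
  have cv: "continuous_on {0..1} v" and w: "is_weak_deriv v g"
    and hi: "integrable unit_measure (\<lambda>x. \<bar>g x\<bar> ^ N)" and h1: "(\<integral>x. \<bar>g x\<bar> ^ N \<partial>unit_measure) = 1"
    using v weak_deriv_is_weak_deriv unfolding E_def sobolev_def Lp_def g_def by auto
  have hU: "(\<lambda>x. \<bar>g x\<bar> ^ N) absolutely_integrable_on {0<..<1}"
    using hi by (simp add: set_integrable_def integrable_restrict_space)
  have hI: "(\<lambda>x. \<bar>g x\<bar> ^ N) integrable_on {x..y}" if "0 < x" "y < 1" for x y
    by (rule set_lebesgue_integral_eq_integral(1), rule set_integrable_subset[OF hU]) (use that in auto)
  have gI: "g absolutely_integrable_on {x..y}" if "0 < x" "y < 1" for x y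
    using w that unfolding is_weak_deriv_def by (intro locally_integrable_interval) auto
  define H where "H x y = integral {x..y} (\<lambda>x. \<bar>g x\<bar> ^ N)" for x y
  have inc: "\<bar>v y - v x\<bar> ^ N \<le> (y - x) ^ (N - 1) * H x y" if "0 < x" "x < y" "y < 1" for x y
    using integral_power_le[OF N that(2) gI hI] weak_deriv_FTC[OF cv w, of x y] that
    by (simp add: H_def integral_unique)
  have "H a p + H p q = H a q"
    unfolding H_def by (rule Henstock_Kurzweil_Integration.integral_combine) (use apq hI in auto)
  also have "\<dots> \<le> integral {0<..<1} (\<lambda>x. \<bar>g x\<bar> ^ N)"
    unfolding H_def
    by (rule integral_subset_le) (use apq hI hU set_lebesgue_integral_eq_integral(1) in auto)
  also have "\<dots> = 1" using h1 lebesgue_integral_eq_integral[OF hi] by simp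
  finally have tot: "H a p + H p q \<le> 1" .
  have H0: "H p q \<ge> 0" unfolding H_def by (rule integral_nonneg) (use apq hI in auto)
  have pa: "(p - a) ^ (N - 1) > 0" using apq by simp
  have 1: "\<bar>v p - v a\<bar> ^ N / (p - a) ^ (N - 1) \<le> H a p"
    using inc[of a p] apq pa by (simp add: divide_le_eq mult.commute)
  show "\<bar>v p - v a\<bar> ^ N \<le> (p - a) ^ (N - 1)"
  proof -
    have "\<bar>v p - v a\<bar> ^ N / (p - a) ^ (N - 1) \<le> 1" using 1 tot H0 by linarith
    then show ?thesis using pa by (simp add: divide_le_eq)
  qed
  have "\<bar>v q - v p\<bar> ^ N \<le> (q - p) ^ (N - 1) * H p q" using inc apq by simp
  also have "\<dots> \<le> (q - p) ^ (N - 1) * (1 - \<bar>v p - v a\<bar> ^ N / (p - a) ^ (N - 1))"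
    using 1 tot apq by (intro mult_left_mono) auto
  finally show "\<bar>v q - v p\<bar> ^ N \<le> (q - p) ^ (N - 1) * (1 - \<bar>v p - v a\<bar> ^ N / (p - a) ^ (N - 1))" .
qed

text \<open>The auxiliary point of \<open>E_energy_split\<close> tends to 0; continuity of
  \<open>v\<close> at 0 together with \<open>v 0 = 0\<close> turns the first increment into
  \<open>v p\<close>.\<close>

lemma E_increment:
  assumes v: "v \<in> E N" and pq: "0 < p" "p < q" "q < 1"
  shows "\<bar>v q - v p\<bar> ^ N \<le> (q - p) ^ (N - 1) * (1 - peak_ratio N v p)"
    and "\<bar>v p\<bar> ^ N \<le> p ^ (N - 1)"
proof -
  have cv: "continuous_on {0..1} v" and v0: "v 0 = 0"
    using v unfolding E_def sobolev_def by auto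
  have "(v \<longlongrightarrow> v 0) (at 0 within {0..1})" using cv by (simp add: continuous_on)
  then have "(v \<longlongrightarrow> 0) (at 0 within {0<..<1})"
    unfolding v0 by (rule tendsto_within_subset) auto
  moreover have "at (0::real) within {0<..<1} = at_right 0"
    by (rule at_within_nhd[of _ "{-1<..<1}"]) auto
  ultimately have va: "(v \<longlongrightarrow> 0) (at_right 0)" by simp
  have ev: "\<forall>\<^sub>F a in at_right 0. 0 < a \<and> a < p"
    using pq by (intro eventually_at_rightI[of 0 p]) auto
  have id: "((\<lambda>a. a) \<longlongrightarrow> 0) (at_right (0::real))" by (rule tendsto_ident_at)
  show "\<bar>v p\<bar> ^ N \<le> p ^ (N - 1)"
  proof (rule tendsto_le[of "at_right (0::real)"])
    show "((\<lambda>a. \<bar>v p - v a\<bar> ^ N) \<longlongrightarrow> \<bar>v p\<bar> ^ N) (at_right 0)"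
      using tendsto_power[OF tendsto_rabs[OF tendsto_diff[OF tendsto_const va, of "v p"]], of N] by simp
    show "((\<lambda>a. (p - a) ^ (N - 1)) \<longlongrightarrow> p ^ (N - 1)) (at_right 0)"
      using tendsto_power[OF tendsto_diff[OF tendsto_const id, of p], of "N - 1"] by simp
    show "\<forall>\<^sub>F a in at_right 0. \<bar>v p - v a\<bar> ^ N \<le> (p - a) ^ (N - 1)"
      using ev by eventually_elim (use E_energy_split(2)[OF v] pq in auto)
  qed simp
  show "\<bar>v q - v p\<bar> ^ N \<le> (q - p) ^ (N - 1) * (1 - peak_ratio N v p)"
  proof (rule tendsto_le[of "at_right (0::real)"])
    show "((\<lambda>a. \<bar>v q - v p\<bar> ^ N) \<longlongrightarrow> \<bar>v q - v p\<bar> ^ N) (at_right 0)" by (rule tendsto_const)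
    have "((\<lambda>a. (q - p) ^ (N - 1) * (1 - \<bar>v p - v a\<bar> ^ N / (p - a) ^ (N - 1)))
        \<longlongrightarrow> (q - p) ^ (N - 1) * (1 - \<bar>v p - 0\<bar> ^ N / (p - 0) ^ (N - 1))) (at_right 0)"
      by (intro tendsto_intros va id) (use pq in auto)
    then show "((\<lambda>a. (q - p) ^ (N - 1) * (1 - \<bar>v p - v a\<bar> ^ N / (p - a) ^ (N - 1)))
        \<longlongrightarrow> (q - p) ^ (N - 1) * (1 - peak_ratio N v p)) (at_right 0)"
      by (simp add: peak_ratio_def)
    show "\<forall>\<^sub>F a in at_right 0. \<bar>v q - v p\<bar> ^ N \<le> (q - p) ^ (N - 1) * (1 - \<bar>v p - v a\<bar> ^ N / (p - a) ^ (N - 1))"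
      using ev by eventually_elim (use E_energy_split(1)[OF v] pq in auto)
  qed simp
qed

lemma peak_ratio_le_1:
  assumes "v \<in> E N" "0 < s" "s < 1"
  shows "peak_ratio N v s \<le> 1"
proof -
  obtain q where "s < q" "q < 1" using assms dense by blast
  then show ?thesis using E_increment(2)[OF assms(1,2), of q] assms by (simp add: peak_ratio_def)
qed

text \<open>Two points at relative distance \<open>t\<close> cannot both be nearly extremal for the bound
  \<open>\<bar>v s\<bar>\<^sup>N \<le> s\<^sup>N\<^sup>-\<^sup>1\<close>: if \<open>p\<close> is, almost no energy is left for an increment between \<open>p\<close> and \<open>q\<close>.\<close>

lemma peak_ratio_pair:
  assumes v: "v \<in> E N" and pq: "0 < p" "p < q" "q < 1"
    and small: "1 - peak_ratio N v p \<le> ((q - p) / q) / 4 ^ N"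
  shows "1 - peak_ratio N v q \<ge> ((q - p) / q) / 4"
proof -
  \<comment> \<open>With N-th roots \<open>P\<close> and \<open>Q\<close>, the extremal values at
    \<open>p\<close> and \<open>q\<close> become \<open>p / P\<close> and \<open>q / Q\<close>,
    which avoids fractional powers.\<close>
  define P where "P = p powr (1 / real N)"
  define Q where "Q = q powr (1 / real N)"
  define t where "t = (q - p) / q"
  have t: "0 < t" "t < 1" using pq by (auto simp: t_def field_simps)
  have PN: "P ^ N = p" "P > 0" and QN: "Q ^ N = q" "Q > 0"
    unfolding P_def Q_def using powr_inverse_power[OF N] pq by auto
  have NS: "N = Suc (N - 1)" using N by simp
  have xN: "x ^ N = x * x ^ (N - 1)" for x :: real
    by (subst NS) simp
  have vp: "\<bar>v p\<bar> \<le> p / P"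
  proof (rule power_le_imp_le_base)
    have "\<bar>v p\<bar> ^ Suc (N - 1) \<le> p ^ (N - 1)" using E_increment(2)[OF v pq] NS by simp
    also have "\<dots> = (p / P) ^ Suc (N - 1)" using PN pq NS xN[of p] by (simp add: power_divide del: power_Suc)
    finally show "\<bar>v p\<bar> ^ Suc (N - 1) \<le> (p / P) ^ Suc (N - 1)" .
    show "0 \<le> p / P" using PN pq by simp
  qed
  \<comment> \<open>The factor \<open>1 / 4 ^ N\<close> in the hypothesis becomes
    \<open>1 / 4\<close> after taking the N-th root.\<close>
  have vqp: "\<bar>v q - v p\<bar> \<le> (q - p) / (4 * Q)"
  proof (rule power_le_imp_le_base)
    have "\<bar>v q - v p\<bar> ^ Suc (N - 1) \<le> (q - p) ^ (N - 1) * (1 - peak_ratio N v p)"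
      using E_increment(1)[OF v pq] NS by simp
    also have "\<dots> \<le> (q - p) ^ (N - 1) * (((q - p) / q) / 4 ^ N)"
      using small pq by (intro mult_left_mono) auto
    also have "\<dots> = (q - p) ^ N / (4 ^ N * q)"
      using xN[of "q - p"] by (simp add: field_simps)
    also have "\<dots> = ((q - p) / (4 * Q)) ^ Suc (N - 1)"
      using QN NS by (simp add: power_divide power_mult_distrib del: power_Suc)
    finally show "\<bar>v q - v p\<bar> ^ Suc (N - 1) \<le> ((q - p) / (4 * Q)) ^ Suc (N - 1)" .
    show "0 \<le> (q - p) / (4 * Q)" using QN pq by simp
  qed
  define r where "r = p / q"
  define R where "R = P / Q"
  have r: "r = 1 - t" "0 < r" "r < 1" using pq by (auto simp: r_def t_def field_simps)
  have RN: "R ^ N = r" "R > 0" using PN QN by (auto simp: R_def r_def power_divide)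
  have R1: "R \<le> 1"
  proof (rule ccontr)
    assume "\<not> R \<le> 1"
    then have "1 \<le> R ^ N" by (intro one_le_power) auto
    then show False using RN r by simp
  qed
  \<comment> \<open>Here \<open>N \<ge> 2\<close> gives \<open>R \<ge> sqrt r\<close>, so
    \<open>r / R\<close> is at most \<open>sqrt r\<close>, and the inequality of arithmetic and
    geometric means bounds that by \<open>1 - t / 2\<close>.\<close>
  have "r \<le> R ^ 2" unfolding RN(1)[symmetric] using N RN(2) R1 by (intro power_decreasing) auto
  then have sR: "sqrt r \<le> R" using RN(2) by (intro real_le_lsqrt) auto
  have "r / R \<le> r / sqrt r" using sR r RN(2) by (intro divide_left_mono) auto
  also have "\<dots> = sqrt r" using r by (simp add: real_div_sqrt)
  also have "\<dots> \<le> (1 + r) / 2" using arith_geo_mean_sqrt[of 1 r] r by simp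
  also have "\<dots> = 1 - t / 2" unfolding r(1) by (simp add: field_simps)
  finally have rR: "r / R \<le> 1 - t / 2" .
  have "\<bar>v q\<bar> \<le> \<bar>v p\<bar> + \<bar>v q - v p\<bar>" by linarith
  also have "\<dots> \<le> p / P + (q - p) / (4 * Q)" using vp vqp by linarith
  also have "\<dots> = q / Q * (r / R + t / 4)"
    using PN QN pq by (simp add: r_def R_def t_def field_simps)
  also have "\<dots> \<le> q / Q * (1 - t / 4)"
    using rR QN pq by (intro mult_left_mono) auto
  finally have "\<bar>v q\<bar> ^ N \<le> (q / Q * (1 - t / 4)) ^ N" by (intro power_mono) auto
  also have "\<dots> = q ^ (N - 1) * (1 - t / 4) ^ N"
    using QN pq xN[of q] by (simp add: power_mult_distrib power_divide)
  also have "\<dots> \<le> q ^ (N - 1) * (1 - t / 4)"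
    using power_decreasing[of 1 N "1 - t / 4"] N t pq by (intro mult_left_mono) auto
  finally have "peak_ratio N v q \<le> 1 - t / 4"
    using pq by (simp add: peak_ratio_def divide_le_eq mult.commute)
  then show ?thesis by (simp add: t_def)
qed

text \<open>The point \<open>r\<close> is a limit of a minimising sequence of
  \<open>\<theta> = 1 - \<psi>\<close>. For a near-minimiser \<open>x\<close>, the maximum of
  \<open>\<theta> s\<close> and \<open>\<theta> x\<close> exceeds \<open>\<theta> s\<close> by an
  arbitrarily small amount, so the pair estimate becomes a bound on \<open>\<theta> s\<close> alone.
  Only the distance term is passed to the limit, so \<open>r\<close> may be 0 or 1 and
  \<open>\<psi>\<close> is never evaluated there.\<close>

lemma E_peak:
  assumes v: "v \<in> E N"
  obtains r where "0 \<le> r" "r \<le> 1"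
    "\<And>s. 0 < s \<Longrightarrow> s < 1 \<Longrightarrow> \<bar>s - r\<bar> / max s r / 4 ^ N \<le> 1 - peak_ratio N v s"
proof -
  define \<theta> where "\<theta> s = 1 - peak_ratio N v s" for s
  have \<theta>0: "\<theta> s \<ge> 0" if "0 < s" "s < 1" for s
    using peak_ratio_le_1[OF v that] by (simp add: \<theta>_def)
  have pair: "(q - p) / q / 4 ^ N \<le> max (\<theta> p) (\<theta> q)" if "0 < p" "p < q" "q < 1" for p q
  proof (cases "\<theta> p \<le> (q - p) / q / 4 ^ N")
    case True
    then have "(q - p) / q / 4 \<le> \<theta> q" using peak_ratio_pair[OF v that] by (simp add: \<theta>_def)
    moreover have "(q - p) / q / 4 ^ N \<le> (q - p) / q / 4"
      using that N power_increasing[of 1 N "4::real"] by (intro divide_left_mono) auto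
    ultimately show ?thesis by simp
  qed simp
  have pair': "\<bar>s - r\<bar> / max s r / 4 ^ N \<le> max (\<theta> s) (\<theta> r)" if "0 < s" "s < 1" "0 < r" "r < 1" for s r
  proof -
    consider "s < r" | "s = r" | "r < s" by linarith
    then show ?thesis
    proof cases
      case 1 then show ?thesis using pair[of s r] that by (simp add: max_def)
    next
      case 2 then show ?thesis using \<theta>0 that by simp
    next
      case 3 then show ?thesis using pair[of r s] that by (simp add: max_def split: if_splits)
    qed
  qed
  define m where "m = Inf (\<theta> ` {0<..<1})"
  have bdd: "bdd_below (\<theta> ` {0<..<1})" by (rule bdd_belowI[of _ 0]) (use \<theta>0 in auto)
  have mle: "m \<le> \<theta> s" if "0 < s" "s < 1" for s
    unfolding m_def using bdd that by (intro cInf_lower) auto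
  have "\<exists>r\<in>{0<..<1}. \<theta> r < m + 1 / real (Suc n)" for n
  proof -
    have "\<theta> ` {0<..<1} \<noteq> {}" by auto
    moreover have "Inf (\<theta> ` {0<..<1}) < m + 1 / real (Suc n)" by (simp add: m_def)
    ultimately obtain y where "y \<in> \<theta> ` {0<..<1}" "y < m + 1 / real (Suc n)" by (rule cInf_lessD[elim_format]) auto
    then show ?thesis by auto
  qed
  then have "\<exists>x. \<forall>n. x n \<in> {0<..<1} \<and> \<theta> (x n) < m + 1 / real (Suc n)"
    by (intro choice) blast
  then obtain x where x: "\<And>n. x n \<in> {0<..<1}" "\<And>n. \<theta> (x n) < m + 1 / real (Suc n)" by blast
  have "x n \<in> {0..1}" for n using x(1)[of n] by simp
  then obtain r f where r: "r \<in> {0..1}" "strict_mono f" "(x \<circ> f) \<longlonglongrightarrow> r"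
    using compact_imp_seq_compact[OF compact_Icc[of 0 "1::real"]] unfolding seq_compact_def by blast
  show thesis
  proof (rule that[of r])
    show "0 \<le> r" "r \<le> 1" using r by auto
    fix s :: real assume s: "0 < s" "s < 1"
    have le: "\<bar>s - x (f n)\<bar> / max s (x (f n)) / 4 ^ N \<le> \<theta> s + 1 / real (Suc n)" for n
    proof -
      have "\<bar>s - x (f n)\<bar> / max s (x (f n)) / 4 ^ N \<le> max (\<theta> s) (\<theta> (x (f n)))"
        using pair'[OF s] x(1)[of "f n"] by simp
      moreover have "1 / real (Suc (f n)) \<le> 1 / real (Suc n)"
        using seq_suble[OF r(2), of n] by (intro divide_left_mono) auto
      then have "\<theta> (x (f n)) \<le> \<theta> s + 1 / real (Suc n)" using x(2)[of "f n"] mle[OF s] by linarith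
      moreover have "0 \<le> 1 / real (Suc n)" by simp
      ultimately show ?thesis by linarith
    qed
    have xr: "(\<lambda>n. x (f n)) \<longlonglongrightarrow> r" using r(3) by (simp add: comp_def)
    have "\<bar>s - r\<bar> / max s r / 4 ^ N \<le> \<theta> s + 0"
    proof (rule tendsto_le[OF sequentially_bot])
      show "(\<lambda>n. \<theta> s + 1 / real (Suc n)) \<longlonglongrightarrow> \<theta> s + 0"
        by (intro tendsto_add tendsto_const LIMSEQ_Suc[OF lim_1_over_n])
      show "(\<lambda>n. \<bar>s - x (f n)\<bar> / max s (x (f n)) / 4 ^ N) \<longlonglongrightarrow> \<bar>s - r\<bar> / max s r / 4 ^ N"
        by (intro tendsto_intros tendsto_max xr) (use s in auto)
    qed (use le in simp)
    then show "\<bar>s - r\<bar> / max s r / 4 ^ N \<le> 1 - peak_ratio N v s" by (simp add: \<theta>_def)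
  qed
qed

end

subsection \<open>The uniform bound\<close>

lemma J_eq_nn_integral_lborel:
  "J N \<gamma> v = (\<integral>\<^sup>+ s. ennreal (exp ((ln (exp 1 / s) + \<gamma> * ln (ln (exp 1 / s))) * (v s ^ N / s ^ (N - 1))))
      * indicator {0<..<1} s \<partial>lborel)"
  unfolding J_def by (subst nn_integral_restrict_space) (simp_all add: nn_integral_completion)

section \<open>Elementary estimates of the logarithmic weight and of the majorants\<close>

lemma ln_exp1_div: "(s::real) > 0 \<Longrightarrow> ln (exp 1 / s) = 1 - ln s"
  using ln_div[of "exp 1" s] by simp

text \<open>An arbitrarily small multiple of \<open>L\<close> absorbs any multiple of
  \<open>ln L\<close>; this is \<open>ln x \<le> x - 1\<close> at
  \<open>x = d * L / a\<close>.\<close>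

lemma mult_ln_le:
  fixes a d L :: real
  assumes "a \<ge> 0" "d > 0" "L > 0"
  shows "a * ln L \<le> d * L + a * ln (a / d)"
proof (cases "a = 0")
  case False
  then have a: "a > 0" using assms by simp
  have "ln (d * L / a) \<le> d * L / a - 1" using a assms by (intro ln_le_minus_one) simp
  moreover have "ln L = ln (d * L / a) + ln (a / d)"
    using a assms by (simp add: ln_mult ln_div)
  ultimately have "ln L \<le> d * L / a + ln (a / d)" by linarith
  then have "a * ln L \<le> a * (d * L / a + ln (a / d))" using a by (intro mult_left_mono) auto
  also have "\<dots> = d * L + a * ln (a / d)" using a by (simp add: distrib_left)
  finally show ?thesis .
qed (use assms in simp)

text \<open>Half of the room between \<beta> and 1 absorbs the iterated logarithm. The resulting
  exponent \<open>(1 + \<beta>) / 2\<close> is still below 1, hence the bound is integrable at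
  0.\<close>

lemma exp_log_weight_le_powr:
  fixes \<beta> \<gamma> :: real
  assumes "0 \<le> \<beta>" "\<beta> < 1" "0 \<le> \<gamma>"
  obtains C where "C > 0"
    "\<And>s. 0 < s \<Longrightarrow> s < 1 \<Longrightarrow> exp (\<beta> * (ln (exp 1 / s) + \<gamma> * ln (ln (exp 1 / s)))) \<le> C * s powr (- ((1 + \<beta>) / 2))"
proof
  define d where "d = (1 - \<beta>) / 2"
  define a where "a = \<beta> * \<gamma>"
  have d: "d > 0" and a: "a \<ge> 0" using assms by (auto simp: d_def a_def)
  define C where "C = exp ((1 + \<beta>) / 2 + a * ln (a / d))"
  show "C > 0" by (simp add: C_def)
  fix s :: real assume s: "0 < s" "s < 1"
  define L where "L = ln (exp 1 / s)"
  have L: "L = 1 - ln s" "L > 1" using s by (auto simp: L_def ln_exp1_div)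
  have "a * ln L \<le> d * L + a * ln (a / d)" using mult_ln_le a d L by simp
  then have "\<beta> * (L + \<gamma> * ln L) \<le> (\<beta> + d) * L + a * ln (a / d)"
    by (simp add: a_def algebra_simps)
  moreover have "\<beta> + d = (1 + \<beta>) / 2" by (simp add: d_def field_simps)
  ultimately have le: "\<beta> * (L + \<gamma> * ln L) \<le> (1 + \<beta>) / 2 * L + a * ln (a / d)" by simp
  have "\<beta> * (L + \<gamma> * ln L) \<le> ((1 + \<beta>) / 2 + a * ln (a / d)) + - ((1 + \<beta>) / 2) * ln s"
  proof -
    have "c * L + x = (c + x) + - c * ln s" for c x by (simp add: L(1) algebra_simps)
    then show ?thesis using le by metis
  qed
  then have "exp (\<beta> * (L + \<gamma> * ln L)) \<le> exp (((1 + \<beta>) / 2 + a * ln (a / d)) + - ((1 + \<beta>) / 2) * ln s)"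
    by simp
  also have "\<dots> = C * s powr (- ((1 + \<beta>) / 2))" using s by (simp only: exp_add C_def powr_def) simp
  finally show "exp (\<beta> * (ln (exp 1 / s) + \<gamma> * ln (ln (exp 1 / s)))) \<le> C * s powr (- ((1 + \<beta>) / 2))"
    by (simp add: L_def)
qed

lemma integrable_powr_unit:
  fixes b :: real
  assumes "b < 1"
  shows "integrable lborel (\<lambda>s. indicator {0<..<1} s * s powr (- b))"
proof -
  have "((\<lambda>s. s powr (- b)) has_integral (1 powr (- b + 1) / (- b + 1))) {0..1}"
    using assms by (intro has_integral_powr_from_0) auto
  then have "(\<lambda>s. s powr (- b)) integrable_on {0..1}" by blast
  then have "(\<lambda>s. s powr (- b)) absolutely_integrable_on {0..1}"
    by (rule nonnegative_absolutely_integrable_1) simp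
  then have "(\<lambda>s. s powr (- b)) absolutely_integrable_on {0<..<1}"
    by (rule set_integrable_subset) auto
  then have "integrable lebesgue (\<lambda>s. indicator {0<..<1} s * s powr (- b))"
    by (simp add: set_integrable_def)
  then show ?thesis by (subst (asm) integrable_completion) auto
qed

lemma integrable_exp_abs:
  fixes c :: real
  assumes "c > 0"
  shows "integrable lborel (\<lambda>y. exp (- (c * \<bar>y\<bar>)))"
proof -
  have "((\<lambda>y. exp (- c * y)) has_integral exp (- c * 0) / c) {0..}"
    by (rule has_integral_exp_minus_to_infinity[OF assms])
  then have "(\<lambda>y. exp (- c * y)) absolutely_integrable_on {0..}"
    by (intro nonnegative_absolutely_integrable_1) auto
  then have "integrable lebesgue (\<lambda>y. indicator {0..} y * exp (- c * y))"
    by (simp add: set_integrable_def)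
  then have i: "integrable lborel (\<lambda>y. indicator {0..} y * exp (- c * y))"
    by (subst (asm) integrable_completion) auto
  have "integrable lborel (\<lambda>y. indicator {0..} (0 + (-1) * y) * exp (- c * (0 + (-1) * y)))"
    by (rule lborel_integrable_real_affine[OF i]) simp
  then have "integrable lborel (\<lambda>y. indicator {0..} y * exp (- c * y) + indicator {0..} (- y) * exp (c * y))"
    using i by (intro Bochner_Integration.integrable_add) simp_all
  then show ?thesis
  proof (rule Bochner_Integration.integrable_bound)
    show "AE y in lborel. norm (exp (- (c * \<bar>y\<bar>))) \<le> norm (indicator {0..} y * exp (- c * y) + indicator {0..} (- y) * exp (c * y))"
    proof (rule AE_I2)
      fix y :: real
      show "norm (exp (- (c * \<bar>y\<bar>))) \<le> norm (indicator {0..} y * exp (- c * y) + indicator {0..} (- y) * exp (c * y))"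
        by (cases "y \<ge> 0") (auto simp: indicator_def)
    qed
  qed simp
qed

text \<open>Only the ratio \<open>A / B\<close> survives, not the centre. Height and decay rate of
  the peak both scale like \<open>(1 - ln r) / r\<close>, so the peak integral will not depend on
  \<open>r\<close>.\<close>

lemma nn_integral_exp_abs_affine:
  fixes A B r :: real
  assumes "B > 0" "A \<ge> 0"
  shows "(\<integral>\<^sup>+ s. ennreal (A * exp (- (B * \<bar>s - r\<bar>))) \<partial>lborel) = ennreal (A / B) * (\<integral>\<^sup>+ y. ennreal (exp (- \<bar>y\<bar>)) \<partial>lborel)"
proof -
  have "(\<integral>\<^sup>+ s. ennreal (A * exp (- (B * \<bar>s - r\<bar>))) \<partial>lborel)
      = ennreal \<bar>1 / B\<bar> * (\<integral>\<^sup>+ y. ennreal (A * exp (- (B * \<bar>(r + (1 / B) * y) - r\<bar>))) \<partial>lborel)"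
    by (rule nn_integral_real_affine) (use assms in auto)
  also have "(\<lambda>y. ennreal (A * exp (- (B * \<bar>(r + (1 / B) * y) - r\<bar>)))) = (\<lambda>y. ennreal A * ennreal (exp (- \<bar>y\<bar>)))"
    using assms by (intro ext) (simp add: ennreal_mult abs_mult)
  also have "ennreal \<bar>1 / B\<bar> * (\<integral>\<^sup>+ y. ennreal A * ennreal (exp (- \<bar>y\<bar>)) \<partial>lborel)
      = ennreal (A / B) * (\<integral>\<^sup>+ y. ennreal (exp (- \<bar>y\<bar>)) \<partial>lborel)"
    using assms by (subst nn_integral_cmult) (auto simp flip: ennreal_mult mult.assoc)
  finally show ?thesis .
qed

text \<open>Away from \<open>r\<close> the exponent loses a fixed factor, which makes the integrand integrable; within
  \<open>r / 2 < s < 2 * r\<close> the weight is comparable with \<open>(1 - ln r) / r\<close>, the reciprocal of the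
  width of the exponential decay.\<close>

lemma exp_peak_bound:
  fixes s r \<eta> \<phi> :: real
  assumes s: "0 < s" "s < 1" and r: "0 \<le> r" "r \<le> 1" and \<eta>: "0 < \<eta>" "\<eta> \<le> 1"
    and \<phi>: "\<phi> \<le> 1 - \<eta> * (\<bar>s - r\<bar> / max s r)"
  defines "k \<equiv> ln (exp 1 / s) + ln (ln (exp 1 / s))"
  shows "exp (k * \<phi>) \<le> exp ((1 - \<eta> / 2) * k)
     + (if r > 0 then 4 * exp 1 * (1 - ln r) / r * exp (- (\<eta> * (1 - ln r) / (4 * r) * \<bar>s - r\<bar>)) else 0)"
proof -
  define t where "t = \<bar>s - r\<bar> / max s r"
  define L where "L = 1 - ln s"
  define M where "M = 1 - ln r"
  have L: "L > 1" using s by (simp add: L_def)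
  have k: "k = L + ln L" using s by (simp add: k_def L_def ln_exp1_div)
  have kL: "L \<le> k" using L by (simp add: k)
  have "k * \<phi> \<le> k * (1 - \<eta> * t)" using \<phi> kL L by (intro mult_left_mono) (auto simp: t_def)
  then have e1: "exp (k * \<phi>) \<le> exp (k * (1 - \<eta> * t))" by simp
  show ?thesis
  proof (cases "t \<ge> 1 / 2")
    case True
    then have "\<eta> / 2 \<le> \<eta> * t" using \<eta> by simp
    then have "k * (1 - \<eta> * t) \<le> k * (1 - \<eta> / 2)" using kL L by (intro mult_left_mono) auto
    then have "exp (k * \<phi>) \<le> exp ((1 - \<eta> / 2) * k)" using e1 by (simp add: mult.commute)
    moreover have "0 \<le> (if r > 0 then 4 * exp 1 * (1 - ln r) / r * exp (- (\<eta> * (1 - ln r) / (4 * r) * \<bar>s - r\<bar>)) else 0)"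
    proof (cases "r > 0")
      case True
      then have "1 - ln r \<ge> 0" using r by (simp add: ln_le_zero_iff order_trans[of _ 0])
      then show ?thesis using True by simp
    qed simp
    ultimately show ?thesis by linarith
  next
    case False
    \<comment> \<open>For \<open>r = 0\<close> the relative distance of every \<open>s\<close> is 1,
      so only the far estimate is ever used.\<close>
    have r0: "r > 0"
    proof (rule ccontr)
      assume "\<not> r > 0"
      then have "r = 0" using r by simp
      then have "t = 1" using s by (simp add: t_def)
      then show False using False by simp
    qed
    have M: "M \<ge> 1" using r r0 by (simp add: M_def)
    have "\<bar>s - r\<bar> < max s r / 2" using False s by (simp add: t_def not_le field_simps less_max_iff_disj)
    then have sr: "r / 2 < s" "s < 2 * r" by (auto simp: max_def split: if_splits)
    \<comment> \<open>On the dyadic range around \<open>r\<close> the logarithms \<open>L\<close>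
      and \<open>M\<close> differ by at most \<open>ln 2\<close>, hence by at most 1, which makes
      them comparable up to a factor 2 in both directions.\<close>
    have ln2: "ln 2 \<le> (1::real)" using ln_le_minus_one[of 2] by simp
    have "ln (r / 2) \<le> ln s" using sr s r0 by simp
    then have LM: "L \<le> M + 1" using r0 ln2 by (simp add: L_def M_def ln_div)
    have "ln s \<le> ln (2 * r)" using sr s r0 by simp
    then have MhL: "M / 2 \<le> L" using r0 ln2 L by (simp add: L_def M_def ln_mult)
    have "exp k = L * exp L" using L by (simp add: k exp_add)
    also have "exp L = exp 1 / s" using s by (simp add: L_def exp_diff)
    also have "L * (exp 1 / s) \<le> (2 * M) * (exp 1 / (r / 2))"
      using LM M L sr s r0 by (intro mult_mono divide_left_mono) auto
    also have "\<dots> = 4 * exp 1 * M / r" by simp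
    finally have ek: "exp k \<le> 4 * exp 1 * M / r" .
    have "max s r \<le> 2 * r" using sr r0 by simp
    then have "\<bar>s - r\<bar> / (2 * r) \<le> t"
      unfolding t_def using s by (intro divide_left_mono) auto
    moreover have "M / 2 \<le> k" using MhL kL by linarith
    ultimately have "(M / 2) * (\<bar>s - r\<bar> / (2 * r)) \<le> k * t"
      using M r0 by (intro mult_mono) auto
    then have "\<eta> * ((M / 2) * (\<bar>s - r\<bar> / (2 * r))) \<le> \<eta> * (k * t)"
      using \<eta> by (intro mult_left_mono) auto
    then have "k * (1 - \<eta> * t) \<le> k + - (\<eta> * M / (4 * r) * \<bar>s - r\<bar>)"
      by (simp add: algebra_simps)
    then have "exp (k * (1 - \<eta> * t)) \<le> exp k * exp (- (\<eta> * M / (4 * r) * \<bar>s - r\<bar>))"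
      by (simp flip: exp_add)
    also have "\<dots> \<le> 4 * exp 1 * M / r * exp (- (\<eta> * M / (4 * r) * \<bar>s - r\<bar>))"
      using ek by (intro mult_right_mono) auto
    finally have "exp (k * \<phi>) \<le> 4 * exp 1 * M / r * exp (- (\<eta> * M / (4 * r) * \<bar>s - r\<bar>))"
      using e1 by linarith
    then show ?thesis using r0 exp_gt_zero[of "(1 - \<eta> / 2) * k"] unfolding M_def if_P[OF r0] by linarith
  qed
qed

text \<open>Reduction to \<gamma> = 1 and \<open>\<bar>v\<bar>\<close>. For a nonnegative power the
  exponent increases with \<gamma>, as \<open>ln L > 0\<close>. For a negative power it can be
  positive only when \<gamma> is so negative that the weight changes sign, and then
  \<open>mult_ln_le\<close> with \<open>d = 1\<close> bounds it by a constant.\<close>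

lemma log_weight_power_le:
  fixes v s \<gamma> :: real
  assumes s: "0 < s" "s < 1" and \<gamma>: "\<gamma> \<le> 1" and \<psi>: "\<bar>v\<bar> ^ n / s ^ m \<le> 1"
  defines "L \<equiv> ln (exp 1 / s)"
  shows "exp ((L + \<gamma> * ln L) * (v ^ n / s ^ m)) \<le> exp ((L + ln L) * (\<bar>v\<bar> ^ n / s ^ m)) + exp \<bar>\<bar>\<gamma>\<bar> * ln \<bar>\<gamma>\<bar>\<bar>"
proof (cases "v ^ n \<ge> 0")
  case True
  have L: "L > 1" using s by (simp add: L_def ln_exp1_div)
  have eq: "v ^ n = \<bar>v\<bar> ^ n" using True by (simp flip: power_abs)
  have "\<gamma> * ln L \<le> 1 * ln L" using \<gamma> L by (intro mult_right_mono) auto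
  then have "(L + \<gamma> * ln L) * (v ^ n / s ^ m) \<le> (L + ln L) * (\<bar>v\<bar> ^ n / s ^ m)"
    unfolding eq using s by (intro mult_right_mono) auto
  then have "exp ((L + \<gamma> * ln L) * (v ^ n / s ^ m)) \<le> exp ((L + ln L) * (\<bar>v\<bar> ^ n / s ^ m))" by simp
  then show ?thesis using exp_gt_zero[of "\<bar>\<bar>\<gamma>\<bar> * ln \<bar>\<gamma>\<bar>\<bar>"] by linarith
next
  case False
  have L: "L > 1" using s by (simp add: L_def ln_exp1_div)
  define \<psi>' where "\<psi>' = \<bar>v\<bar> ^ n / s ^ m"
  have "\<bar>v\<bar> ^ n = - (v ^ n)" using False by (simp flip: power_abs)
  then have eq: "v ^ n / s ^ m = - \<psi>'" by (simp add: \<psi>'_def)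
  have \<psi>01: "0 \<le> \<psi>'" "\<psi>' \<le> 1" using \<psi> s by (auto simp: \<psi>'_def)
  have "\<bar>\<gamma>\<bar> * ln L \<le> 1 * L + \<bar>\<gamma>\<bar> * ln (\<bar>\<gamma>\<bar> / 1)" using L by (intro mult_ln_le) auto
  moreover have "- \<gamma> * ln L \<le> \<bar>\<gamma>\<bar> * ln L" using L by (intro mult_right_mono) auto
  ultimately have "- (L + \<gamma> * ln L) \<le> \<bar>\<bar>\<gamma>\<bar> * ln \<bar>\<gamma>\<bar>\<bar>" by simp
  then have "- (L + \<gamma> * ln L) * \<psi>' \<le> \<bar>\<bar>\<gamma>\<bar> * ln \<bar>\<gamma>\<bar>\<bar> * \<psi>'" using \<psi>01 by (intro mult_right_mono)
  also have "\<dots> \<le> \<bar>\<bar>\<gamma>\<bar> * ln \<bar>\<gamma>\<bar>\<bar>" using \<psi>01 by (intro mult_left_le) auto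
  finally have "(L + \<gamma> * ln L) * (v ^ n / s ^ m) \<le> \<bar>\<bar>\<gamma>\<bar> * ln \<bar>\<gamma>\<bar>\<bar>"
    unfolding eq by (simp only: minus_mult_left[symmetric] minus_mult_right[symmetric])
  then have "exp ((L + \<gamma> * ln L) * (v ^ n / s ^ m)) \<le> exp \<bar>\<bar>\<gamma>\<bar> * ln \<bar>\<gamma>\<bar>\<bar>" by simp
  then show ?thesis using exp_gt_zero[of "(L + ln L) * (\<bar>v\<bar> ^ n / s ^ m)"] by linarith
qed

theorem J_bounded:
  assumes N: "N \<ge> 2" and \<gamma>: "\<gamma> \<le> 1"
  shows "(SUP v\<in>E N. J N \<gamma> v) < \<infinity>"
proof -
  define \<eta> :: real where "\<eta> = 1 / 4 ^ N"
  have \<eta>: "0 < \<eta>" "\<eta> \<le> 1" by (auto simp: \<eta>_def)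
  obtain C where C: "C > 0" "\<And>s. 0 < s \<Longrightarrow> s < 1 \<Longrightarrow>
      exp ((1 - \<eta> / 2) * (ln (exp 1 / s) + 1 * ln (ln (exp 1 / s)))) \<le> C * s powr (- ((1 + (1 - \<eta> / 2)) / 2))"
    using exp_log_weight_le_powr[of "1 - \<eta> / 2" 1] \<eta> by (auto simp: field_simps)
  define b where "b = (1 + (1 - \<eta> / 2)) / 2"
  have b: "b < 1" using \<eta> by (simp add: b_def)
  define D where "D = exp \<bar>\<bar>\<gamma>\<bar> * ln \<bar>\<gamma>\<bar>\<bar>"
  define far where "far s = indicator {0<..<1} s * (D + C * s powr (- b))" for s :: real
  define near where "near r s = (if r > 0 then 4 * exp 1 * (1 - ln r) / r
      * exp (- (\<eta> * (1 - ln r) / (4 * r) * \<bar>s - r\<bar>)) else 0)" for r s :: real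
  have far_nn: "far s \<ge> 0" for s using C(1) by (simp add: far_def D_def)
  have "integrable lborel (\<lambda>s. indicator {0<..<1} s * D + C * (indicator {0<..<1} s * s powr (- b)))"
    by (intro Bochner_Integration.integrable_add integrable_mult_right integrable_powr_unit b) auto
  then have "integrable lborel far"
    by (simp add: far_def[abs_def] algebra_simps)
  then have far_fin: "(\<integral>\<^sup>+ s. ennreal (far s) \<partial>lborel) < \<infinity>"
    using far_nn unfolding integrable_iff_bounded by simp
  have exp_fin: "(\<integral>\<^sup>+ y. ennreal (exp (- \<bar>y\<bar>)) \<partial>lborel) < \<infinity>"
    using integrable_exp_abs[of 1] unfolding integrable_iff_bounded by simp
  \<comment> \<open>The coefficient \<open>16 * exp 1 / \<eta>\<close> is the height
    \<open>4 * exp 1 * (1 - ln r) / r\<close> of the peak divided by its decay rate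
    \<open>\<eta> * (1 - ln r) / (4 * r)\<close>.\<close>
  define T where "T = (\<integral>\<^sup>+ s. ennreal (far s) \<partial>lborel)
      + ennreal (16 * exp 1 / \<eta>) * (\<integral>\<^sup>+ y. ennreal (exp (- \<bar>y\<bar>)) \<partial>lborel)"
  have "J N \<gamma> v \<le> T" if v: "v \<in> E N" for v
  proof -
    obtain r where r: "0 \<le> r" "r \<le> 1"
      "\<And>s. 0 < s \<Longrightarrow> s < 1 \<Longrightarrow> \<bar>s - r\<bar> / max s r / 4 ^ N \<le> 1 - peak_ratio N v s"
      using E_peak[OF N v] by metis
    have near_nn: "near r s \<ge> 0" for s
    proof (cases "r > 0")
      case True
      then have "1 - ln r \<ge> 0" using r ln_le_zero_iff[of r] by linarith
      then show ?thesis unfolding near_def if_P[OF True]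
        using True by (intro mult_nonneg_nonneg divide_nonneg_nonneg) auto
    qed (simp add: near_def)
    have pt: "exp ((ln (exp 1 / s) + \<gamma> * ln (ln (exp 1 / s))) * (v s ^ N / s ^ (N - 1))) \<le> far s + near r s"
      if s: "0 < s" "s < 1" for s
    proof -
      have "\<bar>v s\<bar> ^ N / s ^ (N - 1) \<le> 1 - \<eta> * (\<bar>s - r\<bar> / max s r)"
        using r(3)[OF s] by (simp add: peak_ratio_def \<eta>_def mult.commute)
      from exp_peak_bound[OF s r(1,2) \<eta> this]
      have "exp ((ln (exp 1 / s) + ln (ln (exp 1 / s))) * (\<bar>v s\<bar> ^ N / s ^ (N - 1)))
          \<le> C * s powr (- b) + near r s"
        using C(2)[OF s] unfolding near_def b_def by simp
      moreover have "\<bar>v s\<bar> ^ N / s ^ (N - 1) \<le> 1"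
        using peak_ratio_le_1[OF N v s] by (simp add: peak_ratio_def)
      from log_weight_power_le[OF s \<gamma> this]
      have "exp ((ln (exp 1 / s) + \<gamma> * ln (ln (exp 1 / s))) * (v s ^ N / s ^ (N - 1)))
          \<le> exp ((ln (exp 1 / s) + ln (ln (exp 1 / s))) * (\<bar>v s\<bar> ^ N / s ^ (N - 1))) + D"
        unfolding D_def .
      moreover have "far s = D + C * s powr (- b)" using s by (simp add: far_def)
      ultimately show ?thesis by linarith
    qed
    have "J N \<gamma> v \<le> (\<integral>\<^sup>+ s. ennreal (far s) + ennreal (near r s) \<partial>lborel)"
      unfolding J_eq_nn_integral_lborel
    proof (rule nn_integral_mono)
      fix s :: real
      show "ennreal (exp ((ln (exp 1 / s) + \<gamma> * ln (ln (exp 1 / s))) * (v s ^ N / s ^ (N - 1)))) * indicator {0<..<1} s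
          \<le> ennreal (far s) + ennreal (near r s)"
      proof (cases "0 < s \<and> s < 1")
        case True
        then have "ennreal (exp ((ln (exp 1 / s) + \<gamma> * ln (ln (exp 1 / s))) * (v s ^ N / s ^ (N - 1))))
            \<le> ennreal (far s + near r s)" using pt by (intro ennreal_leI) simp
        then show ?thesis using True far_nn near_nn by simp
      qed simp
    qed
    also have "\<dots> = (\<integral>\<^sup>+ s. ennreal (far s) \<partial>lborel) + (\<integral>\<^sup>+ s. ennreal (near r s) \<partial>lborel)"
      by (rule nn_integral_add) (auto simp: far_def near_def)
    also have "\<dots> \<le> T"
      unfolding T_def
    proof (intro add_left_mono)
      show "(\<integral>\<^sup>+ s. ennreal (near r s) \<partial>lborel)
          \<le> ennreal (16 * exp 1 / \<eta>) * (\<integral>\<^sup>+ y. ennreal (exp (- \<bar>y\<bar>)) \<partial>lborel)"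
      proof (cases "r > 0")
        case True
        then have "ln r \<le> 0" using r by simp
        then have M: "1 - ln r > 0" by simp
        have "4 * exp 1 * (1 - ln r) / r / (\<eta> * (1 - ln r) / (4 * r)) = 16 * exp 1 / \<eta>"
          using M True \<eta> by (simp add: divide_simps)
        then show ?thesis
          using nn_integral_exp_abs_affine[of "\<eta> * (1 - ln r) / (4 * r)" "4 * exp 1 * (1 - ln r) / r" r] True M \<eta>
          by (simp add: near_def)
      qed (simp add: near_def)
    qed
    finally show ?thesis .
  qed
  then have "(SUP v\<in>E N. J N \<gamma> v) \<le> T" by (intro SUP_least)
  also have "T < \<infinity>"
    unfolding T_def using far_fin exp_fin by (simp add: ennreal_mult_less_top)
  finally show ?thesis .
qed

subsection \<open>Asymptotics along the Moser sequence\<close>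

text \<open>With \<open>x = j * s\<close>, the quotient \<open>w\<^sub>j\<^sup>N / s\<^sup>N\<^sup>-\<^sup>1\<close> of the Moser sequence is \<open>moser_profile N x\<close>.\<close>

definition moser_profile :: "nat \<Rightarrow> real \<Rightarrow> real" where
  "moser_profile N x = (if x \<le> 1 then x else 1 / x ^ (N - 1))"

lemma moser_profile_measurable [measurable]: "moser_profile N \<in> borel_measurable borel"
  unfolding moser_profile_def by measurable

lemma moser_ratio_eq_profile:
  assumes N: "N \<ge> 2" and j: "j \<ge> 1" and s: "s > 0"
  shows "moser N j s ^ N / s ^ (N - 1) = moser_profile N (real j * s)"
proof -
  define c where "c = real j powr (1 / real N)"
  have cN: "c ^ N = real j" using powr_inverse_power[OF N, of "real j"] by (simp add: c_def)
  obtain n where n: "N = Suc n" using N by (cases N) auto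
  have eq: "moser N j s = c * min s (1 / real j)" unfolding c_def by (rule moser_eq_min[OF N j])
  show ?thesis
  proof (cases "real j * s \<le> 1")
    case True
    then have "s \<le> 1 / real j" using j by (simp add: field_simps)
    then have "moser N j s ^ N = real j * s ^ N" by (simp add: eq power_mult_distrib cN)
    then show ?thesis using True s by (simp add: moser_profile_def n)
  next
    case False
    then have "\<not> s \<le> 1 / real j" using j by (simp add: field_simps)
    then have "moser N j s = c * (1 / real j)" by (simp add: eq)
    then have "moser N j s ^ N = real j * (1 / real j) ^ N" by (simp only: power_mult_distrib cN)
    also have "\<dots> = 1 / real j ^ n" using j by (simp add: n power_one_over)
    finally show ?thesis using False by (simp add: moser_profile_def n power_mult_distrib)
  qed
qed

text \<open>The bound \<open>1 / x\<close> makes the profile at most a half beyond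
  \<open>x = 2\<close>; the one with \<open>- ln x\<close> controls the logarithm as
  \<open>x\<close> tends to 0; the last is the linear drop that yields exponential domination for
  \<open>x \<le> 2\<close>.\<close>

lemma moser_profile_bounds:
  assumes N: "N \<ge> 2" and x: "x > 0"
  shows "0 \<le> moser_profile N x" "moser_profile N x \<le> 1" "1 \<le> x \<Longrightarrow> moser_profile N x \<le> 1 / x"
    and "moser_profile N x * (- ln x) \<le> 1"
    and "x \<le> 2 \<Longrightarrow> \<bar>x - 1\<bar> / 2 \<le> 1 - moser_profile N x"
proof -
  show p0: "0 \<le> moser_profile N x" using x by (simp add: moser_profile_def)
  have px: "moser_profile N x \<le> 1 / x" if "1 \<le> x"
  proof -
    have "x \<le> x ^ (N - 1)" using power_increasing[of 1 "N - 1" x] N that by simp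
    then show ?thesis using that by (auto simp: moser_profile_def intro!: divide_left_mono)
  qed
  then show "1 \<le> x \<Longrightarrow> moser_profile N x \<le> 1 / x" .
  show p1: "moser_profile N x \<le> 1"
  proof (cases "1 \<le> x")
    case True
    then have "1 / x \<le> 1" by simp
    then show ?thesis using px[OF True] by linarith
  qed (simp add: moser_profile_def)
  show "moser_profile N x * (- ln x) \<le> 1"
  proof (cases "1 \<le> x")
    case True
    then have "moser_profile N x * (- ln x) \<le> 0" using p0 by (intro mult_nonneg_nonpos) auto
    then show ?thesis by linarith
  next
    case False
    have "ln (1 / x) \<le> 1 / x - 1" using x by (intro ln_le_minus_one) simp
    then have "x * (- ln x) \<le> x * (1 / x - 1)" using x by (intro mult_left_mono) (auto simp: ln_div)
    also have "\<dots> \<le> 1" using x by (simp add: right_diff_distrib)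
    finally show ?thesis using False by (simp add: moser_profile_def)
  qed
  show "\<bar>x - 1\<bar> / 2 \<le> 1 - moser_profile N x" if "x \<le> 2"
  proof (cases "1 \<le> x")
    case True
    have "(x - 1) / 2 \<le> (x - 1) / x" using True that by (intro divide_left_mono) auto
    also have "\<dots> = 1 - 1 / x" using True by (simp add: diff_divide_distrib)
    finally show ?thesis using px[OF True] True by simp
  qed (simp add: moser_profile_def)
qed

definition moser_integrand :: "nat \<Rightarrow> real \<Rightarrow> nat \<Rightarrow> real \<Rightarrow> real" where
  "moser_integrand N \<gamma> j s = exp ((ln (exp 1 / s) + \<gamma> * ln (ln (exp 1 / s))) * moser_profile N (real j * s))"

lemma moser_integrand_measurable [measurable]: "moser_integrand N \<gamma> j \<in> borel_measurable borel"
  unfolding moser_integrand_def by measurable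

text \<open>The cut at \<open>2 / j\<close> is where the profile has fallen to at most
  \<open>1 / 2\<close>, which makes the integrand dominated uniformly in \<open>j\<close>.\<close>

definition moser_far :: "nat \<Rightarrow> real \<Rightarrow> nat \<Rightarrow> real" where
  "moser_far N \<gamma> j = (\<integral>s. indicator {2 / real j<..<1} s * moser_integrand N \<gamma> j s \<partial>lborel)"

text \<open>The mass concentrates in a window of width \<open>1 / (j * M)\<close> around \<open>1 / j\<close>, where \<open>M = 1 + ln j\<close>, i.e.
  \<open>1 / j = exp (1 - M)\<close>. The substitution \<open>s = (1 + y / M) / j\<close> and the factor \<open>M powr (1 - \<gamma>)\<close>
  give the integrand on \<open>0 < s \<le> 2 / j\<close> a nontrivial limit.\<close>

definition moser_rescaled :: "nat \<Rightarrow> real \<Rightarrow> nat \<Rightarrow> real \<Rightarrow> real" where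
  "moser_rescaled N \<gamma> j y = (let M = 1 + ln (real j) in
     indicator {-M<..M} y * (M powr (1 - \<gamma>) * (1 / (real j * M)) * moser_integrand N \<gamma> j (1 / real j + 1 / (real j * M) * y)))"

definition moser_near :: "nat \<Rightarrow> real \<Rightarrow> nat \<Rightarrow> real" where
  "moser_near N \<gamma> j = (\<integral>y. moser_rescaled N \<gamma> j y \<partial>lborel)"

text \<open>The first-order drop of \<open>moser_profile\<close> at 1, whose one-sided slopes are 1
  on the left and \<open>- (N - 1)\<close> on the right.\<close>

definition moser_decay :: "nat \<Rightarrow> real \<Rightarrow> real" where
  "moser_decay N y = (if y \<le> 0 then - y else (real N - 1) * y)"

context
  fixes N :: nat
  assumes N: "N \<ge> 2"
begin

lemma J_moser:
  assumes "j \<ge> 1"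
  shows "J N \<gamma> (moser N j) = (\<integral>\<^sup>+ s. ennreal (moser_integrand N \<gamma> j s) * indicator {0<..<1} s \<partial>lborel)"
  unfolding J_eq_nn_integral_lborel moser_integrand_def
proof (rule nn_integral_cong)
  fix s :: real
  show "ennreal (exp ((ln (exp 1 / s) + \<gamma> * ln (ln (exp 1 / s))) * (moser N j s ^ N / s ^ (N - 1)))) * indicator {0<..<1} s
      = ennreal (exp ((ln (exp 1 / s) + \<gamma> * ln (ln (exp 1 / s))) * moser_profile N (real j * s))) * indicator {0<..<1} s"
  proof (cases "s > 0")
    case True
    show ?thesis by (simp only: moser_ratio_eq_profile[OF N assms True])
  qed simp
qed

section \<open>Limits of the two contributions, beyond \<open>2 / j\<close> and near
  \<open>1 / j\<close>\<close>

lemma moser_far_dominated: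
  obtains C where "C > 0"
    "\<And>j s. \<bar>indicator {2 / real j<..<1} s * moser_integrand N \<gamma> j s\<bar> \<le> C * (indicator {0<..<1} s * s powr (- (3 / 4)))"
proof -
  obtain C where C: "C > 0" "\<And>s. 0 < s \<Longrightarrow> s < 1 \<Longrightarrow>
      exp (1 / 2 * (ln (exp 1 / s) + \<bar>\<gamma>\<bar> * ln (ln (exp 1 / s)))) \<le> C * s powr (- ((1 + 1 / 2) / 2))"
    using exp_log_weight_le_powr[of "1 / 2" "\<bar>\<gamma>\<bar>"] by auto
  have "\<bar>indicator {2 / real j<..<1} s * moser_integrand N \<gamma> j s\<bar> \<le> C * (indicator {0<..<1} s * s powr (- (3 / 4)))" for j s
  proof (cases "s \<in> {2 / real j<..<1}")
    case True
    have s: "0 < s" "s < 1" using True by (auto intro: le_less_trans[of 0 "2 / real j"])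
    \<comment> \<open>For \<open>j = 0\<close> the quotient \<open>2 / real j\<close> is 0 by
      convention and the profile is evaluated at 0, so the bound also covers this index.\<close>
    have js: "real j * s > 2 \<or> j = 0" using True by (auto simp: field_simps)
    define L where "L = ln (exp 1 / s)"
    have L: "L > 1" using s by (simp add: L_def ln_exp1_div)
    define p where "p = moser_profile N (real j * s)"
    have p: "0 \<le> p" "p \<le> 1 / 2"
    proof -
      show "0 \<le> p" unfolding p_def using js s by (cases "j = 0") (auto simp: moser_profile_def)
      show "p \<le> 1 / 2"
      proof (cases "j = 0")
        case False
        then have "p \<le> 1 / (real j * s)" unfolding p_def using js s by (intro moser_profile_bounds[OF N]) auto
        also have "\<dots> \<le> 1 / 2" using js False by (intro divide_left_mono) auto
        finally show ?thesis .
      qed (simp add: p_def moser_profile_def)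
    qed
    have "(L + \<gamma> * ln L) * p \<le> (L + \<bar>\<gamma>\<bar> * ln L) * p" using p L by (intro mult_right_mono add_left_mono) auto
    also have "\<dots> \<le> (L + \<bar>\<gamma>\<bar> * ln L) * (1 / 2)" using p L by (intro mult_left_mono) auto
    finally have "exp ((L + \<gamma> * ln L) * p) \<le> exp (1 / 2 * (L + \<bar>\<gamma>\<bar> * ln L))" by (simp add: mult.commute)
    also have "\<dots> \<le> C * s powr (- (3 / 4))" using C(2)[OF s] by (simp add: L_def)
    finally show ?thesis using True s by (simp add: moser_integrand_def L_def p_def)
  qed (use C(1) in simp)
  then show thesis using that C(1) by blast
qed

lemma moser_far_integrable:
  "integrable lborel (\<lambda>s. indicator {2 / real j<..<1} s * moser_integrand N \<gamma> j s)"
proof -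
  obtain C where C: "C > 0"
    "\<And>j s. \<bar>indicator {2 / real j<..<1} s * moser_integrand N \<gamma> j s\<bar> \<le> C * (indicator {0<..<1} s * s powr (- (3 / 4)))"
    using moser_far_dominated[of \<gamma>] by metis
  have "integrable lborel (\<lambda>s. C * (indicator {0<..<1} s * s powr (- (3 / 4))))"
    by (intro integrable_mult_right integrable_powr_unit) simp
  then show ?thesis
    by (rule Bochner_Integration.integrable_bound)
       (measurable, intro AE_I2, simp only: real_norm_def, rule order_trans[OF C(2) abs_ge_self])
qed

lemma moser_far_tendsto: "(\<lambda>j. moser_far N \<gamma> j) \<longlonglongrightarrow> 1"
proof -
  obtain C where C: "C > 0"
    "\<And>j s. \<bar>indicator {2 / real j<..<1} s * moser_integrand N \<gamma> j s\<bar> \<le> C * (indicator {0<..<1} s * s powr (- (3 / 4)))"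
    using moser_far_dominated[of \<gamma>] by metis
  have "(\<lambda>j. \<integral>s. indicator {2 / real j<..<1} s * moser_integrand N \<gamma> j s \<partial>lborel) \<longlonglongrightarrow> (\<integral>s. indicator {0<..<1::real} s \<partial>lborel)"
  proof (rule integral_dominated_convergence[where w = "\<lambda>s. C * (indicator {0<..<1} s * s powr (- (3 / 4)))"])
    show "(\<lambda>s. indicator {0<..<1::real} s :: real) \<in> borel_measurable lborel" by measurable
    show "(\<lambda>s. indicator {2 / real j<..<1} s * moser_integrand N \<gamma> j s) \<in> borel_measurable lborel" for j by measurable
    show "integrable lborel (\<lambda>s. C * (indicator {0<..<1} s * s powr (- (3 / 4))))"
      by (intro integrable_mult_right integrable_powr_unit) simp
    show "AE s in lborel. norm (indicator {2 / real j<..<1} s * moser_integrand N \<gamma> j s)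
        \<le> C * (indicator {0<..<1} s * s powr (- (3 / 4)))" for j
      unfolding real_norm_def by (intro AE_I2 C(2))
    have "(\<lambda>j. indicator {2 / real j<..<1} s * moser_integrand N \<gamma> j s) \<longlonglongrightarrow> indicator {0<..<1} s" for s
    proof (cases "0 < s \<and> s < 1")
      case True
      have r: "filterlim (\<lambda>j. real j * s) at_top sequentially"
        using True filterlim_tendsto_pos_mult_at_top[OF tendsto_const[of s] _ filterlim_real_sequentially]
        by (simp add: mult.commute)
      then have ev: "\<forall>\<^sub>F j in sequentially. 2 < real j * s" by (simp add: filterlim_at_top_dense)
      have "(\<lambda>j. moser_profile N (real j * s)) \<longlonglongrightarrow> 0"
      proof (rule tendsto_sandwich[OF _ _ tendsto_const])
        show "\<forall>\<^sub>F j in sequentially. 0 \<le> moser_profile N (real j * s)"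
          using ev by eventually_elim (auto intro!: moser_profile_bounds[OF N])
        show "\<forall>\<^sub>F j in sequentially. moser_profile N (real j * s) \<le> 1 / (real j * s)"
          using ev by eventually_elim (auto intro!: moser_profile_bounds[OF N])
        show "(\<lambda>j. 1 / (real j * s)) \<longlonglongrightarrow> 0"
          using tendsto_inverse_0_at_top[OF r] by (simp add: inverse_eq_divide)
      qed
      then have "(\<lambda>j. moser_integrand N \<gamma> j s) \<longlonglongrightarrow> exp ((ln (exp 1 / s) + \<gamma> * ln (ln (exp 1 / s))) * 0)"
        unfolding moser_integrand_def by (intro tendsto_exp tendsto_mult_left)
      then have "(\<lambda>j. moser_integrand N \<gamma> j s) \<longlonglongrightarrow> indicator {0<..<1} s" using True by simp
      moreover have "\<forall>\<^sub>F j in sequentially. moser_integrand N \<gamma> j s = indicator {2 / real j<..<1} s * moser_integrand N \<gamma> j s"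
        using ev
      proof eventually_elim
        case (elim j)
        then have "real j > 0" using True by (cases "j = 0") auto
        then have "2 / real j < s" using elim by (simp add: field_simps)
        then show ?case using True by simp
      qed
      ultimately show ?thesis by (rule Lim_transform_eventually)
    next
      case False
      have "s \<notin> {2 / real j<..<1}" for j
        using False by (auto intro: le_less_trans[of 0 "2 / real j"])
      then show ?thesis using False by simp
    qed
    then show "AE s in lborel. (\<lambda>j. indicator {2 / real j<..<1} s * moser_integrand N \<gamma> j s) \<longlonglongrightarrow> indicator {0<..<1} s"
      by (intro AE_I2)
  qed
  then show ?thesis by (simp add: moser_far_def)
qed

text \<open>All factors are collected in one exponent, using \<open>1 / j = exp (1 - M)\<close> and
  \<open>ln (e / s) = M - ln x\<close>. Splitting \<open>ln (M - ln x)\<close> into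
  \<open>ln M + ln (1 - ln x / M)\<close> lets the normalising power of \<open>M\<close> cancel up
  to \<open>(1 - p) * ln M\<close>; only \<open>M * (1 - p)\<close> has a nontrivial limit.\<close>

lemma moser_rescaled_eq:
  fixes y :: real
  assumes j: "j \<ge> 2"
  defines "M \<equiv> 1 + ln (real j)"
  defines "x \<equiv> 1 + y / M"
  defines "p \<equiv> moser_profile N x"
  assumes y: "- M < y" "y \<le> M"
  shows "0 < x" "x \<le> 2" "ln x < M" "1 \<le> M"
    and "moser_rescaled N \<gamma> j y
      = exp (1 - M * (1 - p) - p * ln x - \<gamma> * ((1 - p) * ln M) + \<gamma> * (p * ln (1 - ln x / M)))"
proof -
  have j0: "real j > 0" using j by simp
  show M: "1 \<le> M" using j by (simp add: M_def)
  show x: "0 < x" "x \<le> 2" using y M by (auto simp: x_def field_simps)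
  \<comment> \<open>From \<open>x \<le> 2 \<le> j\<close>; this keeps the argument of the logarithm
    in \<open>1 - ln x / M\<close> positive.\<close>
  have "ln x \<le> ln (real j)" using x j by (subst ln_le_cancel_iff) auto
  then show lx: "ln x < M" by (simp add: M_def)
  define s where "s = 1 / real j + 1 / (real j * M) * y"
  have sx: "s = x / real j" using j0 M by (simp add: s_def x_def field_simps)
  have Ls: "ln (exp 1 / s) = M - ln x"
  proof -
    have "ln s = ln x - ln (real j)" using x j0 by (simp add: sx ln_div)
    moreover have "s > 0" using x j0 by (simp add: sx)
    ultimately show ?thesis by (simp only: ln_exp1_div M_def)
  qed
  have "M - ln x = M * (1 - ln x / M)" using M by (simp add: field_simps)
  moreover have q: "0 < 1 - ln x / M" using lx M by (simp add: field_simps)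
  ultimately have lnL: "ln (M - ln x) = ln M + ln (1 - ln x / M)" using M by (simp add: ln_mult)
  have jx: "real j * s = x" using sx j0 by simp
  have MI: "M powr (1 - \<gamma>) = M * exp (- \<gamma> * ln M)"
    using M by (simp add: powr_def left_diff_distrib exp_diff exp_minus divide_inverse)
  have je: "1 / real j = exp (1 - M)" using j0 by (simp add: M_def exp_minus inverse_eq_divide)
  have "moser_rescaled N \<gamma> j y = M powr (1 - \<gamma>) * (1 / (real j * M)) * moser_integrand N \<gamma> j s"
    using y by (simp add: moser_rescaled_def Let_def M_def s_def)
  also have "\<dots> = exp (- \<gamma> * ln M) * (1 / real j) * moser_integrand N \<gamma> j s"
    unfolding MI using M by simp
  also have "\<dots> = exp (- \<gamma> * ln M + (1 - M) + (M - ln x + \<gamma> * (ln M + ln (1 - ln x / M))) * p)"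
    unfolding moser_integrand_def Ls lnL jx je p_def exp_add ..
  also have "- \<gamma> * ln M + (1 - M) + (M - ln x + \<gamma> * (ln M + ln (1 - ln x / M))) * p
      = 1 - M * (1 - p) - p * ln x - \<gamma> * ((1 - p) * ln M) + \<gamma> * (p * ln (1 - ln x / M))"
    by (simp add: algebra_simps)
  finally show "moser_rescaled N \<gamma> j y
      = exp (1 - M * (1 - p) - p * ln x - \<gamma> * ((1 - p) * ln M) + \<gamma> * (p * ln (1 - ln x / M)))" .
qed

lemma moser_rescaled_nonneg: "0 \<le> moser_rescaled N \<gamma> j y"
proof (cases "j = 0")
  case False
  then have "0 \<le> 1 + ln (real j)" by (simp add: ln_ge_zero add_nonneg_nonneg)
  then show ?thesis by (simp add: moser_rescaled_def Let_def moser_integrand_def)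
qed (simp add: moser_rescaled_def)

text \<open>In the exponent, \<open>M * (1 - p)\<close> is at least \<open>\<bar>y\<bar> / 2\<close>
  and \<open>- p * ln x\<close> is at most 1. Since \<gamma> is nonnegative, the term with
  \<open>ln M\<close> only helps and the last one is at most \<gamma>.\<close>

lemma moser_rescaled_dominated:
  assumes \<gamma>: "\<gamma> \<ge> 0" and j: "j \<ge> 2"
  shows "moser_rescaled N \<gamma> j y \<le> exp (2 + \<gamma>) * exp (- (1 / 2 * \<bar>y\<bar>))"
proof (cases "- (1 + ln (real j)) < y \<and> y \<le> 1 + ln (real j)")
  case True
  define M where "M = 1 + ln (real j)"
  define x where "x = 1 + y / M"
  define p where "p = moser_profile N x"
  have y: "- M < y" "y \<le> M" using True by (auto simp: M_def)
  note R = moser_rescaled_eq[OF j y[unfolded M_def], folded M_def, folded x_def, folded p_def]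
  note P = moser_profile_bounds[OF N R(1), folded p_def]
  have "\<bar>y\<bar> / 2 = M * (\<bar>x - 1\<bar> / 2)" using R(4) by (simp add: x_def abs_mult)
  also have "\<dots> \<le> M * (1 - p)" using P(5) R(2,4) by (intro mult_left_mono) auto
  finally have 1: "\<bar>y\<bar> / 2 \<le> M * (1 - p)" .
  have 2: "0 \<le> \<gamma> * ((1 - p) * ln M)" using \<gamma> P(2) R(4) by (intro mult_nonneg_nonneg) auto
  have q: "0 < 1 - ln x / M" using R(3,4) by (simp add: field_simps)
  have "p * ln (1 - ln x / M) \<le> p * (- ln x / M)"
    using ln_le_minus_one[OF q] P(1) by (intro mult_left_mono) auto
  also have "\<dots> = p * (- ln x) / M" by simp
  also have "\<dots> \<le> 1"
  proof -
    have "p * (- ln x) \<le> M" using P(4) R(4) by linarith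
    then show ?thesis using R(4) by (subst divide_le_eq_1_pos) auto
  qed
  finally have 3: "\<gamma> * (p * ln (1 - ln x / M)) \<le> \<gamma>" using \<gamma> by (intro mult_left_le) auto
  have "1 - M * (1 - p) - p * ln x - \<gamma> * ((1 - p) * ln M) + \<gamma> * (p * ln (1 - ln x / M)) \<le> (2 + \<gamma>) + - (1 / 2 * \<bar>y\<bar>)"
    using 1 2 3 P(4) by linarith
  then show ?thesis unfolding R(5) exp_add[symmetric] by simp
next
  case False
  then have "moser_rescaled N \<gamma> j y = 0" by (auto simp: moser_rescaled_def Let_def)
  then show ?thesis by simp
qed

lemma moser_rescaled_measurable [measurable]: "moser_rescaled N \<gamma> j \<in> borel_measurable borel"
  unfolding moser_rescaled_def Let_def by measurable

lemma moser_rescaled_integrable: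
  assumes "\<gamma> \<ge> 0" "j \<ge> 2"
  shows "integrable lborel (moser_rescaled N \<gamma> j)"
proof (rule Bochner_Integration.integrable_bound)
  show "integrable lborel (\<lambda>y. exp (2 + \<gamma>) * exp (- (1 / 2 * \<bar>y\<bar>)))"
    by (intro integrable_mult_right integrable_exp_abs) simp
  show "AE y in lborel. norm (moser_rescaled N \<gamma> j y) \<le> norm (exp (2 + \<gamma>) * exp (- (1 / 2 * \<bar>y\<bar>)))"
    using moser_rescaled_dominated[OF assms] moser_rescaled_nonneg by (intro AE_I2) simp
qed simp

lemma moser_decay_limit:
  assumes M: "filterlim M at_top sequentially"
  shows "(\<lambda>n::nat. M n * (1 - moser_profile N (1 + y / M n))) \<longlonglongrightarrow> moser_decay N y"
proof (cases "y \<le> 0")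
  case True
  have "\<forall>\<^sub>F n in sequentially. 0 < M n" using M by (simp add: filterlim_at_top_dense)
  then have "\<forall>\<^sub>F n in sequentially. M n * (1 - moser_profile N (1 + y / M n)) = moser_decay N y"
  proof eventually_elim
    case (elim n)
    then have "1 + y / M n \<le> 1" using True by (simp add: divide_nonpos_pos)
    then show ?case using elim True by (simp add: moser_profile_def moser_decay_def)
  qed
  then show ?thesis by (rule tendsto_eventually)
next
  case False
  then have y: "y > 0" by simp
  \<comment> \<open>To the right of 1 the sequence is \<open>- y\<close> times the difference
    quotient of this function at 1 with increment \<open>y / M n\<close>; to the left it is
    constant.\<close>
  have D: "((\<lambda>x. 1 / x ^ (N - 1)) has_real_derivative - (real N - 1)) (at 1)"
    using N by (auto intro!: derivative_eq_intros simp: of_nat_diff)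
  have "filterlim (\<lambda>n. y / M n) (at 0) sequentially"
  proof (rule filterlim_atI)
    show "(\<lambda>n. y / M n) \<longlonglongrightarrow> 0"
      using tendsto_mult_left[OF tendsto_inverse_0_at_top[OF M], of y] by (simp add: divide_inverse)
    have "\<forall>\<^sub>F n in sequentially. 0 < M n" using M by (simp add: filterlim_at_top_dense)
    then show "\<forall>\<^sub>F n in sequentially. y / M n \<noteq> 0" by eventually_elim (use y in auto)
  qed
  then have "(\<lambda>n. (1 / (1 + y / M n) ^ (N - 1) - 1 / 1 ^ (N - 1)) / (y / M n)) \<longlonglongrightarrow> - (real N - 1)"
    using D unfolding DERIV_def by (rule filterlim_compose[rotated])
  then have L: "(\<lambda>n. - y * ((1 / (1 + y / M n) ^ (N - 1) - 1 / 1 ^ (N - 1)) / (y / M n))) \<longlonglongrightarrow> - y * - (real N - 1)"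
    by (rule tendsto_mult_left)
  have e: "- y * - (real N - 1) = moser_decay N y"
  proof -
    have "- y * - (real N - 1) = (real N - 1) * y" by (simp only: minus_mult_minus mult.commute)
    then show ?thesis using y by (simp add: moser_decay_def)
  qed
  have "\<forall>\<^sub>F n in sequentially. - y * ((1 / (1 + y / M n) ^ (N - 1) - 1 / 1 ^ (N - 1)) / (y / M n))
      = M n * (1 - moser_profile N (1 + y / M n))"
  proof -
    have "\<forall>\<^sub>F n in sequentially. 0 < M n" using M by (simp add: filterlim_at_top_dense)
    then show ?thesis
    proof eventually_elim
      case (elim n)
      then have "\<not> 1 + y / M n \<le> 1" using y by (simp add: not_le)
      then have "moser_profile N (1 + y / M n) = 1 / (1 + y / M n) ^ (N - 1)" by (simp add: moser_profile_def)
      moreover have "- y * ((a - 1 / 1 ^ (N - 1)) / (y / M n)) = M n * (1 - a)" for a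
      proof -
        have "y * ((a - 1) / (y / M n)) = (a - 1) * M n" using y elim by simp
        moreover have "- ((a - 1) * M n) = M n * (1 - a)" by (simp add: algebra_simps)
        ultimately have "- (y * ((a - 1) / (y / M n))) = M n * (1 - a)" by metis
        then show ?thesis by (simp only: power_one div_by_1 mult_minus_left)
      qed
      ultimately show ?case by metis
    qed
  qed
  from Lim_transform_eventually[OF L this] show ?thesis unfolding e .
qed

text \<open>Convergence of \<open>M * (1 - p)\<close> forces \<open>(1 - p) * ln M\<close> to 0,
  because \<open>ln M / M\<close> tends to 0. This is why \<gamma> disappears from the
  limit.\<close>

lemma moser_rescaled_tendsto: "(\<lambda>j. moser_rescaled N \<gamma> j y) \<longlonglongrightarrow> exp (1 - moser_decay N y)"
proof -
  define M where "M j = 1 + ln (real j)" for j :: nat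
  define x where "x j = 1 + y / M j" for j
  define p where "p j = moser_profile N (x j)" for j
  have M: "filterlim M at_top sequentially"
    unfolding M_def
    by (intro filterlim_tendsto_add_at_top[OF tendsto_const] filterlim_compose[OF ln_at_top filterlim_real_sequentially])
  have iM: "(\<lambda>j. inverse (M j)) \<longlonglongrightarrow> 0" by (rule tendsto_inverse_0_at_top[OF M])
  have "(\<lambda>j. y / M j) \<longlonglongrightarrow> 0" using tendsto_mult_left[OF iM, of y] by (simp add: divide_inverse)
  then have x1: "x \<longlonglongrightarrow> 1" unfolding x_def using tendsto_add[OF tendsto_const[of 1]] by fastforce
  have lx: "(\<lambda>j. ln (x j)) \<longlonglongrightarrow> 0" using tendsto_ln[OF x1] by simp
  have D: "(\<lambda>j. M j * (1 - p j)) \<longlonglongrightarrow> moser_decay N y"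
    unfolding p_def x_def by (rule moser_decay_limit[OF M])
  have Mpos: "\<forall>\<^sub>F j in sequentially. 0 < M j" using M by (simp add: filterlim_at_top_dense)
  have "(\<lambda>j. M j * (1 - p j) * inverse (M j)) \<longlonglongrightarrow> moser_decay N y * 0"
    by (rule tendsto_mult[OF D iM])
  then have "(\<lambda>j. 1 - p j) \<longlonglongrightarrow> moser_decay N y * 0"
    by (rule Lim_transform_eventually) (use Mpos in \<open>auto elim!: eventually_mono\<close>)
  then have p1: "p \<longlonglongrightarrow> 1" using tendsto_diff[OF tendsto_const[of 1], of "\<lambda>j. 1 - p j" "moser_decay N y * 0"] by simp
  have "(\<lambda>j. ln (M j) / M j) \<longlonglongrightarrow> 0" by (rule filterlim_compose[OF ln_x_over_x_tendsto_0 M])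
  then have "(\<lambda>j. M j * (1 - p j) * (ln (M j) / M j)) \<longlonglongrightarrow> moser_decay N y * 0"
    by (rule tendsto_mult[OF D])
  then have lM: "(\<lambda>j. (1 - p j) * ln (M j)) \<longlonglongrightarrow> moser_decay N y * 0"
    by (rule Lim_transform_eventually) (use Mpos in \<open>auto elim!: eventually_mono\<close>)
  have "(\<lambda>j. 1 - ln (x j) * inverse (M j)) \<longlonglongrightarrow> 1 - 0 * 0"
    by (intro tendsto_diff tendsto_const tendsto_mult lx iM)
  then have "(\<lambda>j. ln (1 - ln (x j) / M j)) \<longlonglongrightarrow> ln (1 - 0 * 0)"
    unfolding divide_inverse by (rule tendsto_ln) simp
  then have q: "(\<lambda>j. p j * ln (1 - ln (x j) / M j)) \<longlonglongrightarrow> 1 * ln (1 - 0 * 0)"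
    by (rule tendsto_mult[OF p1])
  have L: "(\<lambda>j. exp (1 - M j * (1 - p j) - p j * ln (x j) - \<gamma> * ((1 - p j) * ln (M j)) + \<gamma> * (p j * ln (1 - ln (x j) / M j))))
      \<longlonglongrightarrow> exp (1 - moser_decay N y - 1 * 0 - \<gamma> * (moser_decay N y * 0) + \<gamma> * (1 * ln (1 - 0 * 0)))"
    by (intro tendsto_exp tendsto_add tendsto_diff tendsto_const D tendsto_mult lM q p1 lx)
  have "\<forall>\<^sub>F j in sequentially. exp (1 - M j * (1 - p j) - p j * ln (x j) - \<gamma> * ((1 - p j) * ln (M j))
      + \<gamma> * (p j * ln (1 - ln (x j) / M j))) = moser_rescaled N \<gamma> j y"
  proof -
    have "\<forall>\<^sub>F j in sequentially. \<bar>y\<bar> < M j" using M by (simp add: filterlim_at_top_dense)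
    then show ?thesis using eventually_ge_at_top[of 2]
    proof eventually_elim
      case (elim j)
      then have "- (1 + ln (real j)) < y" "y \<le> 1 + ln (real j)" by (auto simp: M_def)
      then show ?case using moser_rescaled_eq(5)[OF elim(2)] by (simp add: p_def x_def M_def)
    qed
  qed
  from Lim_transform_eventually[OF L this] show ?thesis by simp
qed

text \<open>Its value is \<open>e * N / (N - 1)\<close>: the left half line contributes
  \<open>e\<close>, the right one \<open>e / (N - 1)\<close>. Only the lower bound \<open>e\<close>
  is proved.\<close>

definition moser_mass :: real where
  "moser_mass = (\<integral>y. exp (1 - moser_decay N y) \<partial>lborel)"

lemma moser_near_tendsto:
  assumes "\<gamma> \<ge> 0"
  shows "(\<lambda>j. moser_near N \<gamma> j) \<longlonglongrightarrow> moser_mass"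
proof -
  \<comment> \<open>The shift makes the domination, valid from index 2 on, available for all
    terms.\<close>
  have "(\<lambda>j. moser_near N \<gamma> (j + 2)) \<longlonglongrightarrow> moser_mass"
    unfolding moser_near_def moser_mass_def
  proof (rule integral_dominated_convergence[where w = "\<lambda>y. exp (2 + \<gamma>) * exp (- (1 / 2 * \<bar>y\<bar>))"])
    show "(\<lambda>y. exp (1 - moser_decay N y)) \<in> borel_measurable lborel" unfolding moser_decay_def by measurable
    show "integrable lborel (\<lambda>y. exp (2 + \<gamma>) * exp (- (1 / 2 * \<bar>y\<bar>)))"
      by (intro integrable_mult_right integrable_exp_abs) simp
    show "AE y in lborel. (\<lambda>j. moser_rescaled N \<gamma> (j + 2) y) \<longlonglongrightarrow> exp (1 - moser_decay N y)"
      by (rule AE_I2, rule LIMSEQ_ignore_initial_segment[OF moser_rescaled_tendsto])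
    show "AE y in lborel. norm (moser_rescaled N \<gamma> (j + 2) y) \<le> exp (2 + \<gamma>) * exp (- (1 / 2 * \<bar>y\<bar>))" for j
      unfolding real_norm_def abs_of_nonneg[OF moser_rescaled_nonneg]
      by (rule AE_I2, rule moser_rescaled_dominated[OF assms]) simp
    show "moser_rescaled N \<gamma> (j + 2) \<in> borel_measurable lborel" for j by simp
  qed
  then show ?thesis by (rule LIMSEQ_offset[where k = 2])
qed

lemma moser_mass_ge: "exp 1 \<le> moser_mass"
proof -
  have "((\<lambda>y. exp (- 1 * y)) has_integral exp (- 1 * 0) / (1::real)) {0..}"
    by (rule has_integral_exp_minus_to_infinity) simp
  then have h: "((\<lambda>y::real. exp (- y)) has_integral 1) {0..}" by simp
  then have "integral\<^sup>N lborel (\<lambda>y. ennreal (exp (- y)) * indicator {0..} y) = ennreal 1"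
    by (intro nn_integral_has_integral_lebesgue') auto
  then have "(\<integral>\<^sup>+ y. ennreal (exp (- y)) * indicator {0..} y \<partial>lborel) = 1" by simp
  then have n1: "(\<integral>\<^sup>+ y. ennreal (exp y) * indicator {..0} y \<partial>lborel) = 1"
    by (subst nn_integral_real_affine[of _ "-1" 0]) (auto simp: indicator_def)
  have dec: "exp (1 - moser_decay N y) \<le> exp 1 * exp (- (1 * \<bar>y\<bar>))" for y
  proof -
    have "\<bar>y\<bar> \<le> moser_decay N y"
      using N mult_right_mono[of 1 "real N - 1" y] by (auto simp: moser_decay_def)
    then show ?thesis by (simp flip: exp_add)
  qed
  \<comment> \<open>Integrability is essential for a lower bound, since the integral of a
    non-integrable function is 0 by convention.\<close>
  have i: "integrable lborel (\<lambda>y. exp (1 - moser_decay N y))"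
  proof (rule Bochner_Integration.integrable_bound)
    show "integrable lborel (\<lambda>y::real. exp 1 * exp (- (1 * \<bar>y\<bar>)))"
      by (intro integrable_mult_right integrable_exp_abs) simp
    show "(\<lambda>y. exp (1 - moser_decay N y)) \<in> borel_measurable lborel" unfolding moser_decay_def by measurable
  qed (use dec in simp)
  have "ennreal (exp 1) = ennreal (exp 1) * (\<integral>\<^sup>+ y. ennreal (exp y) * indicator {..0} y \<partial>lborel)"
    by (simp add: n1)
  also have "\<dots> = (\<integral>\<^sup>+ y. ennreal (exp 1) * (ennreal (exp y) * indicator {..0} y) \<partial>lborel)"
    by (rule nn_integral_cmult[symmetric]) measurable
  also have "\<dots> \<le> (\<integral>\<^sup>+ y. ennreal (exp (1 - moser_decay N y)) \<partial>lborel)"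
  proof (rule nn_integral_mono)
    fix y :: real
    show "ennreal (exp 1) * (ennreal (exp y) * indicator {..0} y) \<le> ennreal (exp (1 - moser_decay N y))"
      by (cases "y \<le> 0") (auto simp: moser_decay_def exp_add simp flip: ennreal_mult)
  qed
  also have "\<dots> = ennreal moser_mass"
    unfolding moser_mass_def by (rule nn_integral_eq_integral[OF i]) simp
  finally have "ennreal (exp 1) \<le> ennreal moser_mass" .
  moreover have "0 \<le> moser_mass" unfolding moser_mass_def by (rule Bochner_Integration.integral_nonneg) simp
  ultimately show ?thesis by (simp add: ennreal_le_iff)
qed

section \<open>Assembly of the two contributions and the three regimes of \<gamma>\<close>

lemma moser_far_nn_integral:
  "(\<integral>\<^sup>+ s. ennreal (moser_integrand N \<gamma> j s) * indicator {2 / real j<..<1} s \<partial>lborel) = ennreal (moser_far N \<gamma> j)"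
proof -
  have "(\<integral>\<^sup>+ s. ennreal (moser_integrand N \<gamma> j s) * indicator {2 / real j<..<1} s \<partial>lborel)
      = (\<integral>\<^sup>+ s. ennreal (indicator {2 / real j<..<1} s * moser_integrand N \<gamma> j s) \<partial>lborel)"
    by (intro nn_integral_cong) (auto simp: indicator_def)
  also have "\<dots> = ennreal (moser_far N \<gamma> j)"
    unfolding moser_far_def
    by (rule nn_integral_eq_integral[OF moser_far_integrable]) (simp add: moser_integrand_def)
  finally show ?thesis .
qed

lemma moser_near_nn_integral:
  assumes \<gamma>: "\<gamma> \<ge> 0" and j: "j \<ge> 2"
  shows "(\<integral>\<^sup>+ s. ennreal (moser_integrand N \<gamma> j s) * indicator {0<..2 / real j} s \<partial>lborel)
    = ennreal ((1 + ln (real j)) powr (\<gamma> - 1) * moser_near N \<gamma> j)"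
proof -
  define M where "M = 1 + ln (real j)"
  have M: "M \<ge> 1" using j by (simp add: M_def)
  have j0: "real j > 0" using j by simp
  define c where "c = 1 / (real j * M)"
  have c: "c > 0" using M j0 by (simp add: c_def)
  define s where "s y = 1 / real j + c * y" for y
  have sin: "s y \<in> {0<..2 / real j} \<longleftrightarrow> y \<in> {-M<..M}" for y
  proof -
    have "s y = (1 + y / M) / real j" using M j0 by (simp add: s_def c_def field_simps)
    then have "0 < s y \<longleftrightarrow> 0 < 1 + y / M" "s y \<le> 2 / real j \<longleftrightarrow> 1 + y / M \<le> 2"
      using j0 by (simp_all only: zero_less_divide_iff divide_le_cancel) auto
    moreover have "0 < 1 + y / M \<longleftrightarrow> - M < y" "1 + y / M \<le> 2 \<longleftrightarrow> y \<le> M"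
      using M by (auto simp: field_simps)
    ultimately show ?thesis by simp
  qed
  have "(\<integral>\<^sup>+ s. ennreal (moser_integrand N \<gamma> j s) * indicator {0<..2 / real j} s \<partial>lborel)
      = ennreal \<bar>c\<bar> * (\<integral>\<^sup>+ y. ennreal (moser_integrand N \<gamma> j (s y)) * indicator {0<..2 / real j} (s y) \<partial>lborel)"
    unfolding s_def by (rule nn_integral_real_affine) (use c in auto)
  also have "\<dots> = (\<integral>\<^sup>+ y. ennreal \<bar>c\<bar> * (ennreal (moser_integrand N \<gamma> j (s y)) * indicator {0<..2 / real j} (s y)) \<partial>lborel)"
    unfolding s_def by (rule nn_integral_cmult[symmetric]) measurable
  also have "\<dots> = (\<integral>\<^sup>+ y. ennreal (M powr (\<gamma> - 1) * moser_rescaled N \<gamma> j y) \<partial>lborel)"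
  proof (rule nn_integral_cong)
    fix y :: real
    show "ennreal \<bar>c\<bar> * (ennreal (moser_integrand N \<gamma> j (s y)) * indicator {0<..2 / real j} (s y))
        = ennreal (M powr (\<gamma> - 1) * moser_rescaled N \<gamma> j y)"
    proof (cases "y \<in> {-M<..M}")
      case True
      have MM: "M powr (\<gamma> - 1) * M powr (1 - \<gamma>) = 1" using M by (simp flip: powr_add)
      have "moser_rescaled N \<gamma> j y = M powr (1 - \<gamma>) * (c * moser_integrand N \<gamma> j (s y))"
        using True by (simp add: moser_rescaled_def Let_def M_def c_def s_def)
      then have "M powr (\<gamma> - 1) * moser_rescaled N \<gamma> j y = c * moser_integrand N \<gamma> j (s y)"
        using MM by (simp add: mult.assoc[symmetric])
      then show ?thesis using True c sin[of y] by (simp add: ennreal_mult moser_integrand_def)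
    next
      case False
      then have "moser_rescaled N \<gamma> j y = 0" by (auto simp: moser_rescaled_def Let_def M_def)
      then show ?thesis using False sin[of y] by simp
    qed
  qed
  also have "\<dots> = ennreal (\<integral>y. M powr (\<gamma> - 1) * moser_rescaled N \<gamma> j y \<partial>lborel)"
    by (intro nn_integral_eq_integral integrable_mult_right moser_rescaled_integrable \<gamma> j)
       (simp add: moser_rescaled_nonneg)
  also have "\<dots> = ennreal (M powr (\<gamma> - 1) * moser_near N \<gamma> j)"
    by (simp add: moser_near_def)
  finally show ?thesis by (simp add: M_def)
qed

lemma moser_near_nonneg: "0 \<le> moser_near N \<gamma> j"
  unfolding moser_near_def by (rule Bochner_Integration.integral_nonneg) (rule moser_rescaled_nonneg)

lemma moser_far_nonneg: "0 \<le> moser_far N \<gamma> j"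
  unfolding moser_far_def by (rule Bochner_Integration.integral_nonneg) (simp add: moser_integrand_def)

lemma J_moser_decomposition:
  assumes \<gamma>: "\<gamma> \<ge> 0" and j: "j \<ge> 2"
  shows "J N \<gamma> (moser N j) = ennreal ((1 + ln (real j)) powr (\<gamma> - 1) * moser_near N \<gamma> j + moser_far N \<gamma> j)"
proof -
  have j2: "2 / real j > 0" "2 / real j \<le> 1" using j by (auto simp: field_simps)
  \<comment> \<open>The splitting holds only almost everywhere: for \<open>j = 2\<close> the near
    interval contains the point 1, which lies outside \<open>{0<..<1}\<close>.\<close>
  have AB: "AE s in lborel. ennreal (moser_integrand N \<gamma> j s) * indicator {0<..<1} s
      = ennreal (moser_integrand N \<gamma> j s) * indicator {0<..2 / real j} s
        + ennreal (moser_integrand N \<gamma> j s) * indicator {2 / real j<..<1} s"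
    using AE_lborel_singleton[of 1]
  proof eventually_elim
    case (elim s)
    have "s \<in> {0<..<1} \<longleftrightarrow> s \<in> {0<..2 / real j} \<or> s \<in> {2 / real j<..<1}"
      "\<not> (s \<in> {0<..2 / real j} \<and> s \<in> {2 / real j<..<1})"
      unfolding greaterThanLessThan_iff greaterThanAtMost_iff using j2 elim by linarith+
    then have "indicator {0<..<1} s = (indicator {0<..2 / real j} s + indicator {2 / real j<..<1} s :: ennreal)"
      unfolding indicator_def by (auto simp del: greaterThanLessThan_iff greaterThanAtMost_iff)
    then show ?case by (simp only: distrib_left)
  qed
  have "J N \<gamma> (moser N j) = (\<integral>\<^sup>+ s. ennreal (moser_integrand N \<gamma> j s) * indicator {0<..2 / real j} s
        + ennreal (moser_integrand N \<gamma> j s) * indicator {2 / real j<..<1} s \<partial>lborel)"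
    using j by (subst J_moser) (auto intro!: nn_integral_cong_AE AB)
  also have "\<dots> = (\<integral>\<^sup>+ s. ennreal (moser_integrand N \<gamma> j s) * indicator {0<..2 / real j} s \<partial>lborel)
        + (\<integral>\<^sup>+ s. ennreal (moser_integrand N \<gamma> j s) * indicator {2 / real j<..<1} s \<partial>lborel)"
    by (rule nn_integral_add) measurable
  also have "\<dots> = ennreal ((1 + ln (real j)) powr (\<gamma> - 1) * moser_near N \<gamma> j) + ennreal (moser_far N \<gamma> j)"
    by (simp only: moser_near_nn_integral[OF assms] moser_far_nn_integral)
  also have "\<dots> = ennreal ((1 + ln (real j)) powr (\<gamma> - 1) * moser_near N \<gamma> j + moser_far N \<gamma> j)"
    by (rule ennreal_plus[symmetric]) (auto intro!: mult_nonneg_nonneg moser_near_nonneg moser_far_nonneg)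
  finally show ?thesis .
qed

text \<open>The limit \<open>l\<close> of the window weight decides the regime: it is 1 for \<gamma>
  = 1 and 0 for \<gamma> in \<open>[0, 1)\<close>, while the far part always contributes 1.\<close>

lemma J_moser_tendsto:
  assumes \<gamma>: "\<gamma> \<ge> 0" and X: "(\<lambda>j. (1 + ln (real j)) powr (\<gamma> - 1)) \<longlonglongrightarrow> l"
  shows "(\<lambda>j. J N \<gamma> (moser N j)) \<longlonglongrightarrow> ennreal (l * moser_mass + 1)"
proof -
  have "(\<lambda>j. (1 + ln (real j)) powr (\<gamma> - 1) * moser_near N \<gamma> j + moser_far N \<gamma> j) \<longlonglongrightarrow> l * moser_mass + 1"
    by (intro tendsto_intros X moser_near_tendsto \<gamma> moser_far_tendsto)
  then have "(\<lambda>j. ennreal ((1 + ln (real j)) powr (\<gamma> - 1) * moser_near N \<gamma> j + moser_far N \<gamma> j))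
      \<longlonglongrightarrow> ennreal (l * moser_mass + 1)" by (rule tendsto_ennrealI)
  moreover have "\<forall>\<^sub>F j in sequentially. ennreal ((1 + ln (real j)) powr (\<gamma> - 1) * moser_near N \<gamma> j + moser_far N \<gamma> j)
      = J N \<gamma> (moser N j)"
    using eventually_ge_at_top[of 2] by eventually_elim (simp add: J_moser_decomposition[OF \<gamma>])
  ultimately show ?thesis by (rule Lim_transform_eventually)
qed

lemma filterlim_1_plus_ln: "filterlim (\<lambda>j. 1 + ln (real j)) at_top sequentially"
  by (intro filterlim_tendsto_add_at_top[OF tendsto_const] filterlim_compose[OF ln_at_top filterlim_real_sequentially])

lemma J_moser_critical: "(\<lambda>j. J N 1 (moser N j)) \<longlonglongrightarrow> ennreal (moser_mass + 1)"
proof -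
  have "\<forall>\<^sub>F j in sequentially. 0 < 1 + ln (real j)"
    using filterlim_1_plus_ln by (simp add: filterlim_at_top_dense)
  then have "(\<lambda>j. (1 + ln (real j)) powr (1 - 1)) \<longlonglongrightarrow> 1"
    by (intro tendsto_eventually) (auto elim!: eventually_mono)
  then show ?thesis using J_moser_tendsto[of 1 1] by simp
qed

lemma J_moser_supercritical:
  assumes "\<gamma> > 1"
  shows "(\<lambda>j. J N \<gamma> (moser N j)) \<longlonglongrightarrow> \<infinity>"
proof -
  have "filterlim (\<lambda>j. (1 + ln (real j)) powr (\<gamma> - 1)) at_top sequentially"
    by (rule filterlim_compose[OF real_powr_at_top filterlim_1_plus_ln]) (use assms in simp)
  moreover have "0 < moser_mass" using moser_mass_ge exp_gt_zero[of 1] by linarith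
  ultimately have "filterlim (\<lambda>j. (1 + ln (real j)) powr (\<gamma> - 1) * moser_near N \<gamma> j) at_top sequentially"
    using moser_near_tendsto[of \<gamma>] assms
      filterlim_tendsto_pos_mult_at_top[of "moser_near N \<gamma>" moser_mass sequentially "\<lambda>j. (1 + ln (real j)) powr (\<gamma> - 1)"]
    by (simp add: mult.commute)
  then have "filterlim (\<lambda>j. moser_far N \<gamma> j + (1 + ln (real j)) powr (\<gamma> - 1) * moser_near N \<gamma> j) at_top sequentially"
    by (rule filterlim_tendsto_add_at_top[OF moser_far_tendsto])
  then have "(\<lambda>j. ennreal (moser_far N \<gamma> j + (1 + ln (real j)) powr (\<gamma> - 1) * moser_near N \<gamma> j)) \<longlonglongrightarrow> \<infinity>"
    by (simp add: ennreal_tendsto_top_eq_at_top)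
  moreover have "\<forall>\<^sub>F j in sequentially. ennreal (moser_far N \<gamma> j + (1 + ln (real j)) powr (\<gamma> - 1) * moser_near N \<gamma> j)
      = J N \<gamma> (moser N j)"
    using eventually_ge_at_top[of 2] by eventually_elim (use assms in \<open>simp add: J_moser_decomposition add.commute\<close>)
  ultimately show ?thesis by (rule Lim_transform_eventually)
qed

text \<open>A sandwich that covers negative \<gamma>: the far part alone is a lower bound for every
  \<gamma>, and replacing \<gamma> by \<open>max \<gamma> 0\<close> gives an upper bound for which
  the near domination is available.\<close>

lemma J_moser_subcritical:
  assumes "\<gamma> < 1"
  shows "(\<lambda>j. J N \<gamma> (moser N j)) \<longlonglongrightarrow> 1"
proof -
  have up: "(\<lambda>j. J N (max \<gamma> 0) (moser N j)) \<longlonglongrightarrow> 1"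
  proof -
    have "(\<lambda>j. (1 + ln (real j)) powr - (1 - max \<gamma> 0)) \<longlonglongrightarrow> 0"
      by (rule tendsto_neg_powr[OF _ filterlim_1_plus_ln]) (use assms in simp)
    then show ?thesis using J_moser_tendsto[of "max \<gamma> 0" 0] by simp
  qed
  have lo: "(\<lambda>j. ennreal (moser_far N \<gamma> j)) \<longlonglongrightarrow> 1"
    using tendsto_ennrealI[OF moser_far_tendsto] by simp
  show ?thesis
  proof (rule tendsto_sandwich[OF _ _ lo up])
    show "\<forall>\<^sub>F j in sequentially. ennreal (moser_far N \<gamma> j) \<le> J N \<gamma> (moser N j)"
      using eventually_ge_at_top[of 1]
    proof eventually_elim
      case (elim j)
      have pos: "2 / real j > 0" using elim by simp
      have sub: "{2 / real j<..<1} \<subseteq> {0<..<1}"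
      proof
        fix s assume "s \<in> {2 / real j<..<1}"
        then have "2 / real j < s" "s < 1" by simp_all
        with pos show "s \<in> {0<..<1}" unfolding greaterThanLessThan_iff by linarith
      qed
      show ?case
        unfolding J_moser[OF elim] moser_far_nn_integral[symmetric]
        by (intro nn_integral_mono mult_left_mono) (use sub in \<open>auto simp: indicator_def\<close>)
    qed
    show "\<forall>\<^sub>F j in sequentially. J N \<gamma> (moser N j) \<le> J N (max \<gamma> 0) (moser N j)"
      using eventually_ge_at_top[of 1]
    proof eventually_elim
      case (elim j)
      show ?case
        unfolding J_moser[OF elim]
      proof (rule nn_integral_mono)
        fix s :: real
        show "ennreal (moser_integrand N \<gamma> j s) * indicator {0<..<1} s
            \<le> ennreal (moser_integrand N (max \<gamma> 0) j s) * indicator {0<..<1} s"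
        proof (cases "0 < s \<and> s < 1")
          case True
          then have "ln (exp 1 / s) > 1" by (simp add: ln_exp1_div)
          then have "\<gamma> * ln (ln (exp 1 / s)) \<le> max \<gamma> 0 * ln (ln (exp 1 / s))" by (intro mult_right_mono) auto
          moreover have "0 \<le> moser_profile N (real j * s)" using True elim by (intro moser_profile_bounds[OF N]) simp
          ultimately have "moser_integrand N \<gamma> j s \<le> moser_integrand N (max \<gamma> 0) j s"
            unfolding moser_integrand_def by (simp add: mult_right_mono)
          then show ?thesis by (intro mult_right_mono ennreal_leI) auto
        qed auto
      qed
    qed
  qed
qed

lemma J_zero: "J N \<gamma> (\<lambda>_. 0) = 1"
  using N by (simp add: J_eq_nn_integral_lborel power_0_left)

end

theorem theorem1p4:
  fixes N :: nat
  assumes "N \<ge> 2"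
  shows "(\<forall>\<gamma>::real. (SUP v\<in>E N. J N \<gamma> v) < \<infinity> \<longleftrightarrow> \<gamma> \<le> 1)
    \<and> (sobolev_weakly_converges N (moser N) (\<lambda>_. 0)
        \<and> \<not> ((\<lambda>j. J N 1 (moser N j)) \<longlonglongrightarrow> J N 1 (\<lambda>_. 0)))
    \<and> (\<forall>\<gamma>>1. (\<lambda>j. J N \<gamma> (moser N j)) \<longlonglongrightarrow> \<infinity>)
    \<and> (\<exists>c::real. (\<lambda>j. J N 1 (moser N j)) \<longlonglongrightarrow> ennreal c \<and> c \<ge> exp 1 + 1
        \<and> exp 1 + 1 > (1::real) \<and> J N 1 (\<lambda>_. 0) = 1)
    \<and> (\<forall>\<gamma><1. (\<lambda>j. J N \<gamma> (moser N j)) \<longlonglongrightarrow> 1 \<and> J N \<gamma> (\<lambda>_. 0) = 1)"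
proof -
  have zero: "J N \<gamma> (\<lambda>_. 0) = 1" for \<gamma> by (rule J_zero[OF assms])
  have crit: "(\<lambda>j. J N 1 (moser N j)) \<longlonglongrightarrow> ennreal (moser_mass N + 1)"
    by (rule J_moser_critical[OF assms])
  have ge: "moser_mass N + 1 \<ge> exp 1 + 1" using moser_mass_ge[OF assms] by simp
  have gt: "exp 1 + 1 > (1::real)" by simp
  have not1: "\<not> (\<lambda>j. J N 1 (moser N j)) \<longlonglongrightarrow> J N 1 (\<lambda>_. 0)"
  proof
    assume "(\<lambda>j. J N 1 (moser N j)) \<longlonglongrightarrow> J N 1 (\<lambda>_. 0)"
    then have "ennreal (moser_mass N + 1) = 1" using LIMSEQ_unique[OF crit] by (simp add: zero)
    then show False using ge gt by (simp add: ennreal_eq_1)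
  qed
  have "(SUP v\<in>E N. J N \<gamma> v) < \<infinity> \<longleftrightarrow> \<gamma> \<le> 1" for \<gamma>
  proof
    \<comment> \<open>For \<gamma> above 1 the Moser functions, all members of \<open>E N\<close>,
      would eventually exceed any finite supremum.\<close>
    assume fin: "(SUP v\<in>E N. J N \<gamma> v) < \<infinity>"
    show "\<gamma> \<le> 1"
    proof (rule ccontr)
      assume "\<not> \<gamma> \<le> 1"
      then have "(\<lambda>j. J N \<gamma> (moser N j)) \<longlonglongrightarrow> \<infinity>" using J_moser_supercritical[OF assms] by simp
      from order_tendstoD(1)[OF this fin]
      have "\<forall>\<^sub>F j in sequentially. (SUP v\<in>E N. J N \<gamma> v) < J N \<gamma> (moser N j)" .
      from eventually_happens[OF eventually_conj[OF this eventually_ge_at_top[of 1]]]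
      obtain j where j: "(SUP v\<in>E N. J N \<gamma> v) < J N \<gamma> (moser N j)" "j \<ge> 1" by auto
      have "J N \<gamma> (moser N j) \<le> (SUP v\<in>E N. J N \<gamma> v)"
        by (rule SUP_upper[OF moser_in_E[OF assms j(2)]])
      then show False using j(1) by simp
    qed
  qed (rule J_bounded[OF assms])
  then show ?thesis
    by (intro conjI allI impI exI[of _ "moser_mass N + 1"] crit ge gt not1 zero
        moser_weakly_converges[OF assms] J_moser_supercritical[OF assms] J_moser_subcritical[OF assms])
qed

end
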